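(* The horicompactification $\widehat{\mathbf{H}}$ of the infinite-dimensional separable hyperbolic space $\mathbf{H}$ and the horicompactification $\widehat{\mathcal{H}}$ of the infinite-dimensional separable real Hilbert space $\mathcal{H}$ (with its norm metric) are both homeomorphic to the frustum $\mathbf{F}=\{(x,r)\in\overline{\mathbf{D}}\times[0,1] : \|x\|\le r\}$.
   Context: Let $\mathcal{H}$ be an infinite-dimensional separable real Hilbert space with Hilbert basis $(e_i)_{i\in\mathbb{N}}$ and let $Q(x)=x_0^2-\sum_{i\ge1}x_i^2$, with polarized symmetric bilinear form $(\cdot,\cdot)$. The hyperbolic space is $\mathbf{H}=\{x\in\mathcal{H}: Q(x)=1,\ x_0>0\}$ with metric $d$ given by $\cosh d(x,y)=(x,y)$. $\mathbf{D}$ is the open unit ball of an infinite-dimensional separable real Hilbert space, $\overline{\mathbf{D}}$ is the closed unit ball endowed with the weak topology, and $\mathbf{F}$ has the topology induced from the product $\overline{\mathbf{D}}\times[0,1]$. Horicompactification: for a metric space $(X,d)$ and $x,y,z\in X$, put $\varphi_{y,z}(x)=d(x,y)-d(x,z)\in[-d(y,z),d(y,z)]$. Let $X_2=\prod_{y\ne z\in X}[-d(y,z),d(y,z)]$ with the product topology. The horicompactification $\widehat{X}$ is the closure in $X_2$ of the image of the map $\varphi\colon X\to X_2$, $x\mapsto(\varphi_{y,z}(x))_{y\ne z}$. *)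

theory Defs
  imports "HOL-Analysis.Analysis"
begin

section \<open>Infinite-dimensional separable Hilbert spaces\<close>

text \<open>A real Hilbert space is a type of class \<open>{real_inner, complete_space}\<close>.\<close>

definition infinite_dimensional :: "'a::real_vector set \<Rightarrow> bool" where
  "infinite_dimensional V \<longleftrightarrow> (\<nexists>B. finite B \<and> V \<subseteq> span B)"

definition hilbert_basis :: "(nat \<Rightarrow> 'a::real_inner) \<Rightarrow> bool" where
  "hilbert_basis e \<longleftrightarrow>
     (\<forall>i j. inner (e i) (e j) = (if i = j then 1 else 0)) \<and> closure (span (range e)) = UNIV"

definition weak_topology :: "'a::real_inner topology" where
  "weak_topology =
     topology_generated_by {f -` U | (f :: 'a \<Rightarrow> real) U. bounded_linear f \<and> open U}"

section \<open>The hyperbolic space\<close>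

text \<open>The coordinates of \<open>x\<close> are \<open>x\<^sub>i = inner x (e i)\<close>; for a Hilbert basis \<open>e\<close> the series
  converges by Bessel's inequality.\<close>

definition lorentz_Q :: "(nat \<Rightarrow> 'a::real_inner) \<Rightarrow> 'a \<Rightarrow> real" where
  "lorentz_Q e x = (inner x (e 0))\<^sup>2 - (\<Sum>i. (inner x (e (Suc i)))\<^sup>2)"

definition lorentz_form :: "(nat \<Rightarrow> 'a::real_inner) \<Rightarrow> 'a \<Rightarrow> 'a \<Rightarrow> real" where
  "lorentz_form e x y = (lorentz_Q e (x + y) - lorentz_Q e x - lorentz_Q e y) / 2"

definition hyperbolic_space :: "(nat \<Rightarrow> 'a::real_inner) \<Rightarrow> 'a set" where
  "hyperbolic_space e = {x. lorentz_Q e x = 1 \<and> inner x (e 0) > 0}"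

text \<open>On the hyperbolic space the form is at least \<open>1\<close>, so that \<open>arcosh\<close> yields the unique
  nonnegative \<open>d\<close> with \<open>cosh d = (x, y)\<close>. Values outside the hyperbolic space are
  irrelevant.\<close>

definition hyperbolic_dist :: "(nat \<Rightarrow> 'a::real_inner) \<Rightarrow> 'a \<Rightarrow> 'a \<Rightarrow> real" where
  "hyperbolic_dist e x y = arcosh (lorentz_form e x y)"

section \<open>The horicompactification of a metric space\<close>

text \<open>The carrier \<open>X\<close> and the metric \<open>d\<close> are explicit arguments rather than parameters of the
  locale \<open>Metric_space\<close>, because that locale also constrains \<open>d\<close> outside \<open>X\<close>.\<close>

definition hori_index :: "'a set \<Rightarrow> ('a \<times> 'a) set" where
  "hori_index X = {(y, z). y \<in> X \<and> z \<in> X \<and> y \<noteq> z}"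

definition hori_product :: "'a set \<Rightarrow> ('a \<Rightarrow> 'a \<Rightarrow> real) \<Rightarrow> ('a \<times> 'a \<Rightarrow> real) topology" where
  "hori_product X d =
     product_topology (\<lambda>(y, z). top_of_set {- d y z .. d y z}) (hori_index X)"

definition hori_map :: "'a set \<Rightarrow> ('a \<Rightarrow> 'a \<Rightarrow> real) \<Rightarrow> 'a \<Rightarrow> 'a \<times> 'a \<Rightarrow> real" where
  "hori_map X d x = (\<lambda>(y, z)\<in>hori_index X. d x y - d x z)"

definition horicompactification ::
    "'a set \<Rightarrow> ('a \<Rightarrow> 'a \<Rightarrow> real) \<Rightarrow> ('a \<times> 'a \<Rightarrow> real) topology" where
  "horicompactification X d =
     subtopology (hori_product X d) (hori_product X d closure_of (hori_map X d ` X))"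

section \<open>The frustum\<close>

definition frustum :: "('a::real_inner \<times> real) topology" where
  "frustum =
     subtopology (prod_topology (subtopology weak_topology (cball 0 1)) (top_of_set {0..1}))
       {(x, r). norm x \<le> r}"

end

theory Submission
  imports Defs
begin

text \<open>Both horicompactifications are parametrized by the same compact set of coordinates
  \<open>K = {(a, r). 0 \<le> r \<le> 1, \<Sum>a\<^sub>i\<^sup>2 \<le> r\<^sup>2}\<close> with the product topology, which is homeomorphic to
  the frustum because on bounded sets weak convergence is convergence of coordinates. Put
  \<open>s = sqrt (1 - r\<^sup>2)\<close> and let \<open>v\<close> be the vector with coordinates \<open>a\<close>. In the Hilbert space,
  \<open>(v, r)\<close> with \<open>norm v = r < 1\<close> stands for the point \<open>v / s\<close>, and
  \<open>dist (v / s) y = sqrt (r\<^sup>2 - 2 s (v, y) + s\<^sup>2 (norm y)\<^sup>2) / s\<close>; in the hyperbolic space it stands for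
  \<open>(e\<^sub>0 + v) / s\<close>, whose form with \<open>y\<close> is \<open>(y\<^sub>0 - (v, y)) / s\<close>. In both cases the differences of
  distances extend to continuous functions on \<open>K\<close>: rationalizing the difference of square roots,
  respectively splitting off \<open>ln s\<close>, removes the singularity at \<open>s = 0\<close>. These functions separate
  the points of \<open>K\<close>: evaluating them along an orthonormal sequence, which tends weakly to \<open>0\<close>,
  recovers \<open>r\<close>, and then every coordinate of \<open>v\<close> can be read off. Finally, the points
  with \<open>norm v = r < 1\<close> are dense in \<open>K\<close> since the dimension is infinite, so the closure of the
  image is the image of \<open>K\<close>.\<close>

section \<open>Horicompactifications parametrized by a compact space\<close>

text \<open>\<open>\<Phi> y z\<close> extends the difference of distances to \<open>S\<close>. The
  image of \<open>X\<close> is squeezed between the images of \<open>D\<close> and of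
  \<open>S\<close> under \<open>\<Psi>\<close>; the latter is compact, hence closed, and by density
  it lies in the closure of the former. A continuous injection of a compact space into a Hausdorff
  space is an embedding.\<close>

lemma horicompactification_homeomorphic_compact:
  fixes S :: "'b::t2_space set" and \<Phi> :: "'a \<Rightarrow> 'a \<Rightarrow> 'b \<Rightarrow> real"
  assumes "compact S" "D \<subseteq> S" "S \<subseteq> closure D"
    and triangle: "\<And>x y z. \<lbrakk>x \<in> X; y \<in> X; z \<in> X\<rbrakk> \<Longrightarrow> \<bar>d x y - d x z\<bar> \<le> d y z"
    and cont: "\<And>y z. \<lbrakk>y \<in> X; z \<in> X; y \<noteq> z\<rbrakk> \<Longrightarrow> continuous_on S (\<Phi> y z)"
    and inj: "\<And>p q. \<lbrakk>p \<in> S; q \<in> S; \<And>y z. \<lbrakk>y \<in> X; z \<in> X; y \<noteq> z\<rbrakk> \<Longrightarrow> \<Phi> y z p = \<Phi> y z q\<rbrakk> \<Longrightarrow> p = q"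
    and X_S: "\<And>x. x \<in> X \<Longrightarrow> \<exists>q\<in>S. \<forall>y\<in>X. \<forall>z\<in>X. y \<noteq> z \<longrightarrow> \<Phi> y z q = d x y - d x z"
    and D_X: "\<And>q. q \<in> D \<Longrightarrow> \<exists>x\<in>X. \<forall>y\<in>X. \<forall>z\<in>X. y \<noteq> z \<longrightarrow> \<Phi> y z q = d x y - d x z"
  shows "horicompactification X d homeomorphic_space top_of_set S"
proof -
  define \<Psi> where "\<Psi> q = (\<lambda>(y, z)\<in>hori_index X. \<Phi> y z q)" for q
  have \<Psi>_eq: "\<Psi> q = hori_map X d x"
    if "\<forall>y\<in>X. \<forall>z\<in>X. y \<noteq> z \<longrightarrow> \<Phi> y z q = d x y - d x z" for q x
    using that by (auto simp: \<Psi>_def hori_map_def hori_index_def intro!: restrict_ext)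
  \<comment> \<open>The factors of the product are intervals, not lines. On \<open>D\<close> the
    bound is the triangle inequality; being a closed condition, it passes to \<open>S\<close> by
    density.\<close>
  have bound: "\<Phi> y z q \<in> {- d y z .. d y z}" if yz: "y \<in> X" "z \<in> X" "y \<noteq> z" and "q \<in> S" for y z q
  proof -
    have "closedin (top_of_set S) (S \<inter> \<Phi> y z -` {- d y z .. d y z})"
      using cont[OF yz] by (rule continuous_closedin_preimage) simp
    then obtain C where C: "closed C" "S \<inter> \<Phi> y z -` {- d y z .. d y z} = S \<inter> C"
      by (auto simp: closedin_closed)
    have "D \<subseteq> C"
    proof
      fix q assume "q \<in> D"
      then obtain x where "x \<in> X" "\<Phi> y z q = d x y - d x z" using D_X yz by blast
      with triangle[of x y z] yz have "\<Phi> y z q \<in> {- d y z .. d y z}" by auto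
      then show "q \<in> C" using C(2) \<open>q \<in> D\<close> \<open>D \<subseteq> S\<close> by blast
    qed
    then have "S \<subseteq> C" using \<open>closed C\<close> \<open>S \<subseteq> closure D\<close> closure_minimal by blast
    then show ?thesis using C(2) \<open>q \<in> S\<close> by blast
  qed
  let ?P = "hori_product X d"
  let ?F = "hori_map X d ` X"
  have contP: "continuous_map (top_of_set S) ?P \<Psi>"
    unfolding hori_product_def continuous_map_componentwise
    using cont bound
    by (auto simp: \<Psi>_def hori_index_def continuous_map_in_subtopology)
  have haus: "Hausdorff_space ?P"
    by (auto simp: hori_product_def Hausdorff_space_product_topology Hausdorff_space_subtopology)
  have sub: "?F \<subseteq> \<Psi> ` S"
  proof
    fix g assume "g \<in> ?F"
    then obtain x where x: "x \<in> X" "g = hori_map X d x" by blast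
    from X_S[OF x(1)] obtain q
      where "q \<in> S" "\<forall>y\<in>X. \<forall>z\<in>X. y \<noteq> z \<longrightarrow> \<Phi> y z q = d x y - d x z" ..
    then show "g \<in> \<Psi> ` S" using \<Psi>_eq[of q x] x(2) by (intro image_eqI[of _ _ q]) simp_all
  qed
  have dense: "\<Psi> ` D \<subseteq> ?F"
  proof
    fix g assume "g \<in> \<Psi> ` D"
    then obtain q where q: "q \<in> D" "g = \<Psi> q" by blast
    from D_X[OF q(1)] obtain x
      where "x \<in> X" "\<forall>y\<in>X. \<forall>z\<in>X. y \<noteq> z \<longrightarrow> \<Phi> y z q = d x y - d x z" ..
    then show "g \<in> ?F" using \<Psi>_eq[of q x] q(2) by (intro image_eqI[of _ _ x]) simp_all
  qed
  have "compactin ?P (\<Psi> ` S)"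
    using image_compactin[OF _ contP] \<open>compact S\<close> by (simp add: compactin_subtopology)
  then have "closedin ?P (\<Psi> ` S)" using haus compactin_imp_closedin by blast
  then have "?P closure_of ?F \<subseteq> \<Psi> ` S" by (rule closure_of_minimal[OF sub])
  moreover have "\<Psi> ` S \<subseteq> ?P closure_of ?F"
  proof -
    have "top_of_set S closure_of D = S"
      using assms(2,3) by (simp add: closure_of_subtopology Int_absorb1 Int_absorb2)
    then have "\<Psi> ` S \<subseteq> ?P closure_of (\<Psi> ` D)"
      using continuous_map_image_closure_subset[OF contP, of D] by simp
    also have "\<dots> \<subseteq> ?P closure_of ?F"
      using dense by (rule closure_of_mono)
    finally show ?thesis .
  qed
  ultimately have cl: "?P closure_of ?F = \<Psi> ` S" by blast
  have "inj_on \<Psi> S"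
  proof (rule inj_onI)
    fix p q assume pq: "p \<in> S" "q \<in> S" "\<Psi> p = \<Psi> q"
    show "p = q"
    proof (rule inj[OF pq(1,2)])
      fix y z assume "y \<in> X" "z \<in> X" "y \<noteq> z"
      then show "\<Phi> y z p = \<Phi> y z q"
        using fun_cong[OF pq(3), of "(y, z)"] by (simp add: \<Psi>_def hori_index_def)
    qed
  qed
  have "\<Psi> ` S \<subseteq> topspace ?P" using contP continuous_map_image_subset_topspace by fastforce
  then have "homeomorphic_map (top_of_set S) (horicompactification X d) \<Psi>"
    unfolding horicompactification_def cl
    using \<open>compact S\<close> haus contP \<open>inj_on \<Psi> S\<close>
    by (intro continuous_imp_homeomorphic_map)
       (auto simp: compact_space_subtopology continuous_map_in_subtopology
         intro: Hausdorff_space_subtopology)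
  then show ?thesis
    using homeomorphic_map_imp_homeomorphic_space homeomorphic_space_sym by blast
qed

section \<open>The frustum in coordinates\<close>

text \<open>Bounding all partial sums includes summability and gives conditions on finitely many
  coordinates each, so closedness in the product topology is immediate.\<close>

definition ell2_frustum :: "((nat \<Rightarrow> real) \<times> real) set" where
  "ell2_frustum = {(a, r). 0 \<le> r \<and> r \<le> 1 \<and> (\<forall>n. (\<Sum>i<n. (a i)\<^sup>2) \<le> r\<^sup>2)}"

text \<open>The finitely supported points of the lateral surface below the top. They come from
  points of either space and are already dense.\<close>

definition ell2_frustum_side :: "((nat \<Rightarrow> real) \<times> real) set" where
  "ell2_frustum_side =
     {(a, r). 0 \<le> r \<and> r < 1 \<and> (\<exists>N. (\<forall>i\<ge>N. a i = 0) \<and> (\<Sum>i<N. (a i)\<^sup>2) = r\<^sup>2)}"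

lemma continuous_on_fst_coordinate:
  fixes S :: "(('i \<Rightarrow> 'a::topological_space) \<times> 'b::topological_space) set"
  shows "continuous_on S (\<lambda>p. fst p i)"
proof -
  have 1: "continuous_on S (fst :: (('i \<Rightarrow> 'a::topological_space) \<times> 'b::topological_space) \<Rightarrow> _)"
    by (rule continuous_on_fst[OF continuous_on_id])
  show ?thesis
    using continuous_on_compose[OF 1 continuous_on_subset[OF continuous_on_product_coordinates[of i] subset_UNIV]]
    unfolding o_def .
qed

lemma ell2_frustumD:
  assumes "(a, r) \<in> ell2_frustum"
  shows "0 \<le> r" "r \<le> 1" "(\<Sum>i<n. (a i)\<^sup>2) \<le> r\<^sup>2" "summable (\<lambda>i. (a i)\<^sup>2)" "(\<Sum>i. (a i)\<^sup>2) \<le> r\<^sup>2"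
proof -
  show *: "0 \<le> r" "r \<le> 1" "(\<Sum>i<n. (a i)\<^sup>2) \<le> r\<^sup>2" for n
    using assms by (auto simp: ell2_frustum_def)
  show s: "summable (\<lambda>i. (a i)\<^sup>2)"
    by (rule summableI_nonneg_bounded[where x = "r\<^sup>2"]) (simp_all add: *)
  show "(\<Sum>i. (a i)\<^sup>2) \<le> r\<^sup>2"
    using s by (rule suminf_le_const) (rule *)
qed

lemma ell2_frustum_tendsto_zero:
  assumes "(a, r) \<in> ell2_frustum"
  shows "a \<longlonglongrightarrow> 0"
proof -
  have "(\<lambda>n. sqrt ((a n)\<^sup>2)) \<longlonglongrightarrow> sqrt 0"
    by (intro tendsto_real_sqrt summable_LIMSEQ_zero ell2_frustumD[OF assms])
  then show ?thesis by (simp add: tendsto_rabs_zero_iff)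
qed

text \<open>Tychonoff: the set is closed in a product of compact intervals.\<close>

lemma compact_ell2_frustum: "compact ell2_frustum"
proof -
  let ?C = "PiE (UNIV :: nat set) (\<lambda>_. {-1..1::real})"
  have "compact ?C"
    using compactin_PiE[of "\<lambda>_::nat. euclidean :: real topology" UNIV "\<lambda>_. {-1..1}"]
    by (simp add: euclidean_product_topology)
  then have "compact (?C \<times> {0..1::real})" by (simp add: compact_Times)
  moreover have "closed ell2_frustum"
    unfolding ell2_frustum_def case_prod_unfold
    by (intro closed_Collect_conj closed_Collect_all closed_Collect_le continuous_intros
        continuous_on_fst_coordinate)
  moreover have "ell2_frustum \<subseteq> ?C \<times> {0..1}"
  proof (clarify, intro conjI)
    fix a r assume ar: "(a, r) \<in> ell2_frustum"
    show "r \<in> {0..1}" using ell2_frustumD[OF ar] by simp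
    have "a i \<in> {-1..1}" for i
    proof -
      have "(a i)\<^sup>2 \<le> (\<Sum>j<Suc i. (a j)\<^sup>2)" by (simp add: sum_nonneg)
      also have "\<dots> \<le> r\<^sup>2" by (rule ell2_frustumD[OF ar])
      also have "\<dots> \<le> 1" using ell2_frustumD[OF ar] by (simp add: power_le_one)
      finally have "\<bar>a i\<bar> \<le> 1" by (simp add: abs_square_le_1)
      then show ?thesis by auto
    qed
    then show "a \<in> ?C" by auto
  qed
  ultimately show ?thesis
    by (metis compact_Int_closed inf.absorb_iff2 inf.absorb2)
qed

lemma ell2_frustum_side_subset: "ell2_frustum_side \<subseteq> ell2_frustum"
proof clarify
  fix a r assume "(a, r) \<in> ell2_frustum_side"
  then obtain N where N: "0 \<le> r" "r < 1" "\<forall>i\<ge>N. a i = 0" "(\<Sum>i<N. (a i)\<^sup>2) = r\<^sup>2"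
    by (auto simp: ell2_frustum_side_def)
  have "(\<Sum>i<n. (a i)\<^sup>2) \<le> r\<^sup>2" for n
  proof -
    have "(\<Sum>i<n. (a i)\<^sup>2) \<le> (\<Sum>i<max n N. (a i)\<^sup>2)" by (rule sum_mono2) auto
    also have "\<dots> = (\<Sum>i<N. (a i)\<^sup>2)" using N(3) by (intro sum.mono_neutral_right) auto
    finally show ?thesis using N by simp
  qed
  with N show "(a, r) \<in> ell2_frustum" by (simp add: ell2_frustum_def)
qed

text \<open>A point of the frustum is approached from the side by truncating \<open>a\<close> and moving the missing
  mass to a coordinate that tends to infinity.\<close>

lemma ell2_frustum_subset_closure_side: "ell2_frustum \<subseteq> closure ell2_frustum_side"
proof clarify
  fix a r assume ar: "(a, r) \<in> ell2_frustum"
  note D = ell2_frustumD[OF ar]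
  \<comment> \<open>The factor \<open>t n < 1\<close> keeps the radius below 1 even if
    \<open>r = 1\<close>; \<open>c n\<close> below is the mass that makes the norm exactly
    \<open>t n * r\<close>.\<close>
  define t where "t n = 1 - inverse (real (Suc n))" for n
  have t: "t \<longlonglongrightarrow> 1"
    unfolding t_def using LIMSEQ_inverse_real_of_nat_add_minus[of 1] by simp
  have t01: "0 \<le> t n" "t n < 1" for n by (simp_all add: t_def field_simps)
  define c where "c n = sqrt ((t n * r)\<^sup>2 - (\<Sum>i<n. (t n * a i)\<^sup>2))" for n
  define b where "b n i = (if i < n then t n * a i else if i = n then c n else 0)" for n i
  have "(b n, t n * r) \<in> ell2_frustum_side" for n
  proof -
    have "(\<Sum>i<n. (t n * a i)\<^sup>2) \<le> (t n * r)\<^sup>2"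
      using D(3)[of n] by (simp add: power_mult_distrib flip: sum_distrib_left) (simp add: mult_left_mono)
    then have "(\<Sum>i<Suc n. (b n i)\<^sup>2) = (t n * r)\<^sup>2"
      by (simp add: b_def c_def)
    moreover have "\<forall>i\<ge>Suc n. b n i = 0" by (simp add: b_def)
    moreover have "t n * r < 1"
      using t01[of n] D(1,2) by (smt (verit) mult_left_le)
    ultimately show ?thesis
      using t01[of n] D(1) by (auto simp: ell2_frustum_side_def intro!: exI[of _ "Suc n"])
  qed
  moreover have "(\<lambda>n. (b n, t n * r)) \<longlonglongrightarrow> (a, r)"
  proof (rule tendsto_Pair)
    show "(\<lambda>n. t n * r) \<longlonglongrightarrow> r" using tendsto_mult[OF t tendsto_const[of r]] by simp
    have "(\<lambda>n. b n i) \<longlonglongrightarrow> a i" for i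
    proof (rule Lim_transform_eventually)
      show "(\<lambda>n. t n * a i) \<longlonglongrightarrow> a i" using tendsto_mult[OF t tendsto_const[of "a i"]] by simp
      show "\<forall>\<^sub>F n in sequentially. t n * a i = b n i"
        using eventually_gt_at_top[of i] by eventually_elim (simp add: b_def)
    qed
    then show "b \<longlonglongrightarrow> a"
      using limitin_componentwise[of "\<lambda>_::nat. euclidean :: real topology" UNIV b a sequentially]
      by (simp add: euclidean_product_topology)
  qed
  ultimately show "(a, r) \<in> closure ell2_frustum_side"
    by (meson closed_closure closed_sequentially closure_subset subsetD)
qed

text \<open>Partial sums involve finitely many coordinates and are continuous. By Cauchy-Schwarz and
  the bound 1 on the sums of squares of \<open>a\<close>, their tails are controlled by those of
  \<open>b\<close> alone, so the convergence is uniform.\<close>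

lemma continuous_on_ell2_pairing:
  assumes "summable (\<lambda>i. (b i)\<^sup>2)"
  shows "continuous_on ell2_frustum (\<lambda>p. \<Sum>i. fst p i * b i)"
proof -
  let ?f = "\<lambda>n p. \<Sum>i<n. fst p i * b i :: real"
  have "uniformly_Cauchy_on ell2_frustum ?f"
  proof (rule uniformly_Cauchy_onI')
    fix \<epsilon> :: real assume "\<epsilon> > 0"
    then have "\<epsilon>\<^sup>2 > 0" by simp
    with assms obtain N where N: "\<And>m n. m \<ge> N \<Longrightarrow> \<bar>\<Sum>i=m..<n. (b i)\<^sup>2\<bar> < \<epsilon>\<^sup>2"
      unfolding summable_Cauchy real_norm_def by blast
    have "dist (?f m p) (?f n p) < \<epsilon>" if "p \<in> ell2_frustum" "m \<ge> N" "n > m" for p m n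
    proof -
      obtain a r where p: "p = (a, r)" by force
      note D = ell2_frustumD[OF that(1)[unfolded p]]
      have "(\<Sum>i=m..<n. (a i)\<^sup>2) \<le> (\<Sum>i<n. (a i)\<^sup>2)" by (rule sum_mono2) auto
      also have "\<dots> \<le> 1" using D(1,2) D(3)[of n] by (meson order_trans power_le_one)
      finally have a1: "(\<Sum>i=m..<n. (a i)\<^sup>2) \<le> 1" .
      have "?f n p - ?f m p = (\<Sum>i=m..<n. a i * b i)"
        using sum_diff_nat_ivl[of 0 m n "\<lambda>i. a i * b i"] \<open>n > m\<close> by (simp add: p atLeast0LessThan)
      then have "(?f n p - ?f m p)\<^sup>2 \<le> (\<Sum>i=m..<n. (a i)\<^sup>2) * (\<Sum>i=m..<n. (b i)\<^sup>2)"
        using Cauchy_Schwarz_ineq_sum by metis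
      also have "\<dots> \<le> 1 * (\<Sum>i=m..<n. (b i)\<^sup>2)" using a1 by (intro mult_right_mono sum_nonneg) auto
      also have "\<dots> < \<epsilon>\<^sup>2" using N[OF that(2), of n] by simp
      finally have "\<bar>?f n p - ?f m p\<bar> < \<epsilon>"
        using \<open>\<epsilon> > 0\<close> by (intro power2_less_imp_less[of "\<bar>_\<bar>"]) simp_all
      then show ?thesis by (simp add: dist_real_def abs_minus_commute)
    qed
    then show "\<exists>M. \<forall>p\<in>ell2_frustum. \<forall>m\<ge>M. \<forall>n>m. dist (?f m p) (?f n p) < \<epsilon>" by blast
  qed
  then have "uniform_limit ell2_frustum ?f (\<lambda>p. lim (\<lambda>n. ?f n p)) sequentially"
    using Cauchy_uniformly_convergent uniformly_convergent_uniform_limit_iff by blast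
  then have "continuous_on ell2_frustum (\<lambda>p. lim (\<lambda>n. ?f n p))"
    by (rule uniform_limit_theorem[rotated])
       (auto intro!: always_eventually continuous_on_sum continuous_on_mult_right
         continuous_on_fst_coordinate)
  then show ?thesis by (simp add: suminf_eq_lim)
qed

section \<open>Orthonormal sequences\<close>

locale orthonormal_sequence =
  fixes e :: "nat \<Rightarrow> 'a::{real_inner, complete_space}"
  assumes inner_eq: "inner (e i) (e j) = (if i = j then 1 else 0)"
begin

definition series :: "(nat \<Rightarrow> real) \<Rightarrow> 'a" where
  "series a = (\<Sum>i. a i *\<^sub>R e i)"

lemma norm_eq_1: "norm (e i) = 1"
  by (simp add: norm_eq_sqrt_inner inner_eq)

lemma norm_sum_squared:
  "finite I \<Longrightarrow> (norm (\<Sum>i\<in>I. a i *\<^sub>R e i))\<^sup>2 = (\<Sum>i\<in>I. (a i)\<^sup>2)"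
  by (subst norm_sum_Pythagorean)
     (auto simp: pairwise_def orthogonal_def inner_eq norm_eq_1)

text \<open>Riesz-Fischer: by Pythagoras, blocks of the series have squared norm equal to blocks of
  a convergent real series.\<close>

lemma summable_series:
  assumes "summable (\<lambda>i. (a i)\<^sup>2)"
  shows "summable (\<lambda>i. a i *\<^sub>R e i)"
proof -
  have "Cauchy (\<lambda>n. \<Sum>i<n. a i *\<^sub>R e i)"
  proof (rule CauchyI')
    fix \<epsilon> :: real assume "\<epsilon> > 0"
    then have "\<epsilon>\<^sup>2 > 0" by simp
    with assms obtain N where N: "\<And>m n. m \<ge> N \<Longrightarrow> \<bar>\<Sum>i=m..<n. (a i)\<^sup>2\<bar> < \<epsilon>\<^sup>2"
      unfolding summable_Cauchy real_norm_def by blast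
    have "norm ((\<Sum>i<m. a i *\<^sub>R e i) - (\<Sum>i<n. a i *\<^sub>R e i)) < \<epsilon>" if "m \<ge> N" "n > m" for m n
    proof -
      have "(\<Sum>i<n. a i *\<^sub>R e i) - (\<Sum>i<m. a i *\<^sub>R e i) = (\<Sum>i=m..<n. a i *\<^sub>R e i)"
        using sum_diff_nat_ivl[of 0 m n "\<lambda>i. a i *\<^sub>R e i"] \<open>n > m\<close> by (simp add: atLeast0LessThan)
      then have "(norm ((\<Sum>i<n. a i *\<^sub>R e i) - (\<Sum>i<m. a i *\<^sub>R e i)))\<^sup>2 < \<epsilon>\<^sup>2"
        using N[OF that(1), of n] by (simp add: norm_sum_squared)
      then show ?thesis
        using \<open>\<epsilon> > 0\<close> by (subst norm_minus_commute) (rule power_less_imp_less_base, auto)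
    qed
    then show "\<exists>M. \<forall>m\<ge>M. \<forall>n>m. dist (\<Sum>i<m. a i *\<^sub>R e i) (\<Sum>i<n. a i *\<^sub>R e i) < \<epsilon>"
      unfolding dist_norm by blast
  qed
  then have "convergent (\<lambda>n. \<Sum>i<n. a i *\<^sub>R e i)" by (rule Cauchy_convergent)
  then show ?thesis by (simp only: summable_iff_convergent)
qed

lemma series_eq_sum:
  assumes "\<forall>i\<ge>N. a i = 0"
  shows "series a = (\<Sum>i<N. a i *\<^sub>R e i)"
  unfolding series_def by (rule suminf_finite) (use assms in auto)

lemma series_bounded_linear:
  assumes "summable (\<lambda>i. (a i)\<^sup>2)" "bounded_linear f"
  shows "summable (\<lambda>i. a i *\<^sub>R f (e i))" "f (series a) = (\<Sum>i. a i *\<^sub>R f (e i))"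
proof -
  have "(\<lambda>i. f (a i *\<^sub>R e i)) sums f (series a)"
    unfolding series_def
    by (rule bounded_linear.sums[OF assms(2) summable_sums[OF summable_series[OF assms(1)]]])
  then have "(\<lambda>i. a i *\<^sub>R f (e i)) sums f (series a)"
    using assms(2) by (simp add: linear_simps)
  then show "summable (\<lambda>i. a i *\<^sub>R f (e i))" "f (series a) = (\<Sum>i. a i *\<^sub>R f (e i))"
    by (simp_all add: sums_iff)
qed

lemma inner_series:
  assumes "summable (\<lambda>i. (a i)\<^sup>2)"
  shows "inner (series a) y = (\<Sum>i. a i * inner (e i) y)"
  using series_bounded_linear(2)[OF assms bounded_linear_inner_left[of y]] by simp

lemma inner_series_e:
  assumes "summable (\<lambda>i. (a i)\<^sup>2)"
  shows "inner (series a) (e j) = a j"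
proof -
  have "inner (series a) (e j) = (\<Sum>i. if i = j then a i else 0)"
    unfolding inner_series[OF assms] by (intro suminf_cong) (simp add: inner_eq)
  also have "\<dots> = (\<Sum>i\<in>{j}. if i = j then a i else 0)" by (rule suminf_finite) auto
  finally show ?thesis by simp
qed

lemma norm_series_squared:
  assumes "summable (\<lambda>i. (a i)\<^sup>2)"
  shows "(norm (series a))\<^sup>2 = (\<Sum>i. (a i)\<^sup>2)"
proof -
  have "(norm (series a))\<^sup>2 = (\<Sum>i. a i * inner (e i) (series a))"
    unfolding power2_norm_eq_inner by (rule inner_series[OF assms])
  then show ?thesis
    by (simp add: inner_commute[of "e _"] inner_series_e[OF assms] power2_eq_square)
qed

lemma norm_series_le:
  assumes "(a, r) \<in> ell2_frustum"
  shows "norm (series a) \<le> r"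
proof (rule power2_le_imp_le)
  show "(norm (series a))\<^sup>2 \<le> r\<^sup>2"
    using ell2_frustumD(5)[OF assms] norm_series_squared[OF ell2_frustumD(4)[OF assms]] by simp
qed (rule ell2_frustumD(1)[OF assms])

lemma norm_series_side:
  assumes "(a, r) \<in> ell2_frustum_side"
  shows "norm (series a) = r"
proof -
  obtain N where "0 \<le> r" "\<forall>i\<ge>N. a i = 0" "(\<Sum>i<N. (a i)\<^sup>2) = r\<^sup>2"
    using assms by (auto simp: ell2_frustum_side_def)
  then have "(norm (series a))\<^sup>2 = r\<^sup>2"
    by (simp add: series_eq_sum norm_sum_squared)
  then show ?thesis using \<open>0 \<le> r\<close> by simp
qed

lemma Bessel_inequality: "(\<Sum>i<n. (inner v (e i))\<^sup>2) \<le> (norm v)\<^sup>2"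
proof -
  let ?w = "\<Sum>i<n. inner v (e i) *\<^sub>R e i"
  have "inner ?w v = (\<Sum>i<n. (inner v (e i))\<^sup>2)"
    by (simp add: inner_sum_left inner_commute[of "e _" v] power2_eq_square)
  moreover have "(norm ?w)\<^sup>2 = (\<Sum>i<n. (inner v (e i))\<^sup>2)" by (simp add: norm_sum_squared)
  \<comment> \<open>This squared norm expands to
    \<open>(norm v)\<^sup>2 - (norm ?w)\<^sup>2\<close>.\<close>
  moreover have "0 \<le> inner (v - ?w) (v - ?w)" by simp
  ultimately show ?thesis
    by (simp add: inner_diff_left inner_diff_right inner_commute[of v ?w] power2_norm_eq_inner)
qed

lemma summable_coordinates: "summable (\<lambda>i. (inner v (e i))\<^sup>2)"
  by (rule summableI_nonneg_bounded[where x = "(norm v)\<^sup>2"]) (simp_all add: Bessel_inequality)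

lemma coordinates_in_ell2_frustum:
  assumes "norm v \<le> r" "r \<le> 1"
  shows "(\<lambda>i. inner v (e i), r) \<in> ell2_frustum"
proof -
  have "(\<Sum>i<n. (inner v (e i))\<^sup>2) \<le> r\<^sup>2" for n
    using Bessel_inequality[of v n] power_mono[OF assms(1) norm_ge_zero, of 2] by linarith
  moreover have "0 \<le> r" using assms(1) norm_ge_zero[of v] by linarith
  ultimately show ?thesis using assms(2) by (simp add: ell2_frustum_def)
qed

lemma inner_minus_series_coordinates: "inner (v - series (\<lambda>i. inner v (e i))) (e j) = 0"
  by (simp add: inner_diff_left inner_series_e summable_coordinates)

text \<open>Bessel's inequality for a functional that is not yet known to be an inner product: evaluate
  \<open>f\<close> at \<open>\<Sum>i<n. f (e i) *\<^sub>R e i\<close>.\<close>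

lemma summable_functional_squared:
  fixes f :: "'a \<Rightarrow> real"
  assumes "bounded_linear f"
  shows "summable (\<lambda>i. (f (e i))\<^sup>2)"
proof -
  obtain K where K: "\<And>x. \<bar>f x\<bar> \<le> norm x * K"
    using bounded_linear.bounded[OF assms] unfolding real_norm_def by blast
  have "(\<Sum>i<n. (f (e i))\<^sup>2) \<le> K\<^sup>2" for n
  proof -
    let ?w = "\<Sum>i<n. f (e i) *\<^sub>R e i" and ?s = "\<Sum>i<n. (f (e i))\<^sup>2"
    have "f ?w = ?s"
      using assms by (simp add: linear_sum bounded_linear.linear linear_simps power2_eq_square)
    moreover have "(norm ?w)\<^sup>2 = ?s" by (simp add: norm_sum_squared)
    ultimately have "?s\<^sup>2 \<le> ?s * K\<^sup>2"
      using power_mono[OF K[of ?w], of 2] by (simp add: power_mult_distrib)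
    moreover have "?s \<ge> 0" by (simp add: sum_nonneg)
    ultimately show ?thesis
      by (cases "?s = 0") (auto simp: power2_eq_square[of "sum _ _"])
  qed
  then show ?thesis by (intro summableI_nonneg_bounded[where x = "K\<^sup>2"]) auto
qed

text \<open>Weak continuity of \<open>series\<close>: the functional becomes the pairing with the
  square-summable sequence of its values on \<open>e\<close>.\<close>

lemma continuous_on_series_functional:
  fixes f :: "'a \<Rightarrow> real"
  assumes "bounded_linear f"
  shows "continuous_on ell2_frustum (\<lambda>p. f (series (fst p)))"
proof (rule continuous_on_cong[THEN iffD1, OF refl _ continuous_on_ell2_pairing])
  show "summable (\<lambda>i. (f (e i))\<^sup>2)" by (rule summable_functional_squared[OF assms])
  fix p assume "p \<in> ell2_frustum"
  then have "summable (\<lambda>i. (fst p i)\<^sup>2)" using ell2_frustumD(4)[of "fst p" "snd p"] by simp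
  then show "(\<Sum>i. fst p i * f (e i)) = f (series (fst p))"
    using series_bounded_linear(2)[OF _ assms] by simp
qed

lemma continuous_on_inner_series:
  "continuous_on ell2_frustum (\<lambda>p. inner (series (fst p)) y)"
  by (rule continuous_on_series_functional[OF bounded_linear_inner_left])

end

section \<open>The frustum of a separable Hilbert space\<close>

text \<open>Completeness is stated as a trivial orthogonal complement because both a Hilbert basis
  and a maximal orthonormal set supply it in this form.\<close>

locale complete_orthonormal_sequence = orthonormal_sequence +
  assumes total: "(\<And>i. inner v (e i) = 0) \<Longrightarrow> v = 0"
begin

lemma series_coordinates: "series (\<lambda>i. inner v (e i)) = v"
  using total[of "v - series (\<lambda>i. inner v (e i))"] by (simp add: inner_minus_series_coordinates)

lemma Parseval: "(norm v)\<^sup>2 = (\<Sum>i. (inner v (e i))\<^sup>2)"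
  using norm_series_squared[OF summable_coordinates] by (simp add: series_coordinates)

end

text \<open>The orthogonal complement of \<open>v\<close> is a closed subspace; containing all
  \<open>e i\<close>, it contains \<open>v\<close> itself.\<close>

lemma hilbert_basis_imp_complete_orthonormal_sequence:
  fixes e :: "nat \<Rightarrow> 'a::{real_inner, complete_space}"
  assumes "hilbert_basis e"
  shows "complete_orthonormal_sequence e"
proof
  show "inner (e i) (e j) = (if i = j then 1 else 0)" for i j
    using assms by (simp add: hilbert_basis_def)
  fix v assume v: "\<And>i. inner v (e i) = 0"
  have "subspace {x. inner v x = 0}"
    by (simp add: subspace_def inner_add_right)
  then have "span (range e) \<subseteq> {x. inner v x = 0}"
    using v by (intro span_minimal) auto
  moreover have "closed {x. inner v x = 0}"
    by (intro closed_Collect_eq continuous_intros)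
  ultimately have "closure (span (range e)) \<subseteq> {x. inner v x = 0}"
    by (rule closure_minimal)
  then have "v \<in> {x. inner v x = 0}" using assms unfolding hilbert_basis_def by blast
  then show "v = 0" by simp
qed

section \<open>Existence of a countable orthonormal basis\<close>

definition orthonormal_set :: "'a::real_inner set \<Rightarrow> bool" where
  "orthonormal_set B \<longleftrightarrow> (\<forall>b\<in>B. \<forall>c\<in>B. inner b c = (if b = c then 1 else 0))"

text \<open>Zorn's lemma: a nonzero vector orthogonal to a maximal set could be normalized and added
  to it.\<close>

lemma ex_maximal_orthonormal_set:
  obtains M :: "'a::real_inner set"
  where "orthonormal_set M" "\<And>v. (\<And>b. b \<in> M \<Longrightarrow> inner v b = 0) \<Longrightarrow> v = 0"
proof -
  have "\<exists>M\<in>Collect orthonormal_set. \<forall>X\<in>Collect orthonormal_set. M \<subseteq> X \<longrightarrow> X = (M :: 'a set)"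
  proof (rule subset_Zorn')
    fix C :: "'a set set" assume C: "subset.chain (Collect orthonormal_set) C"
    have "inner b c = (if b = c then 1 else 0)" if bc: "b \<in> \<Union>C" "c \<in> \<Union>C" for b c
    proof -
      obtain X Y where "X \<in> C" "Y \<in> C" "b \<in> X" "c \<in> Y" using bc by blast
      with C obtain Z where "Z \<in> C" "b \<in> Z" "c \<in> Z"
        unfolding subset_chain_def by (meson subsetD)
      then show ?thesis
        using C unfolding subset_chain_def orthonormal_set_def by blast
    qed
    then show "\<Union>C \<in> Collect orthonormal_set" unfolding orthonormal_set_def by blast
  qed
  then obtain M :: "'a set" where M: "orthonormal_set M"
    and max: "\<And>X. orthonormal_set X \<Longrightarrow> M \<subseteq> X \<Longrightarrow> X = M" by auto
  have "v = 0" if v: "\<And>b. b \<in> M \<Longrightarrow> inner v b = 0" for v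
  proof (rule ccontr)
    assume "v \<noteq> 0"
    define u where "u = v /\<^sub>R norm v"
    have "inner u u = 1"
      using \<open>v \<noteq> 0\<close> by (simp add: u_def dot_square_norm power2_eq_square)
    moreover have "inner u b = 0" "inner b u = 0" if "b \<in> M" for b
      using v[OF that] by (simp_all add: u_def inner_commute)
    ultimately have "orthonormal_set (insert u M)"
      using M by (auto simp: orthonormal_set_def)
    then have "u \<in> M" using max[of "insert u M"] by blast
    then have "inner v u = 0" by (rule v)
    then show False using \<open>v \<noteq> 0\<close> by (simp add: u_def)
  qed
  with M show ?thesis by (rule that)
qed

text \<open>Distinct members are at distance \<open>sqrt 2\<close>, so nearby points of a countable
  dense set can be chosen injectively.\<close>

lemma countable_orthonormal_set:
  fixes M :: "'a::real_inner set"
  assumes "separable_space (euclidean :: 'a topology)" "orthonormal_set M"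
  shows "countable M"
proof -
  obtain C :: "'a set" where C: "countable C" "closure C = UNIV"
    using assms(1) by (auto simp: separable_space_def)
  have "\<exists>c\<in>C. dist c b < 1 / 2" for b
    using C(2) closure_approachable[of b C] half_gt_zero[OF zero_less_one] by blast
  then obtain c where c: "\<And>b. c b \<in> C" "\<And>b. dist (c b) b < 1 / 2" by metis
  have "inj_on c M"
  proof (rule inj_onI, rule ccontr)
    fix a b assume ab: "a \<in> M" "b \<in> M" "c a = c b" "a \<noteq> b"
    have "(dist a b)\<^sup>2 = 2"
      using assms(2) ab
      by (simp add: orthonormal_set_def dist_norm power2_norm_eq_inner inner_diff_left inner_diff_right)
    moreover have "dist a b < 1"
      using c(2)[of a] c(2)[of b] dist_triangle_half_l[of a "c a" 1 b] ab(3) by (simp add: dist_commute)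
    then have "(dist a b)\<^sup>2 < 1" by (simp add: power_less_one_iff)
    ultimately show False by simp
  qed
  moreover have "countable (c ` M)"
    using C(1) c(1) by (metis countable_subset image_subsetI)
  ultimately show ?thesis by (rule countable_image_inj_on[rotated])
qed

lemma ex_complete_orthonormal_sequence:
  assumes "infinite_dimensional (UNIV :: 'a::{real_inner, complete_space} set)"
    and "separable_space (euclidean :: 'a topology)"
  shows "\<exists>f :: nat \<Rightarrow> 'a. complete_orthonormal_sequence f"
proof -
  obtain M :: "'a set" where M: "orthonormal_set M"
    and max: "\<And>v. (\<And>b. b \<in> M \<Longrightarrow> inner v b = 0) \<Longrightarrow> v = 0"
    using ex_maximal_orthonormal_set by blast
  have "infinite M"
  proof
    assume fin: "finite M"
    \<comment> \<open>The residual of the projection to a finite \<open>M\<close> is orthogonal to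
      \<open>M\<close>, hence zero, so \<open>M\<close> would span the space.\<close>
    have "v \<in> span M" for v
    proof -
      let ?w = "\<Sum>b\<in>M. inner v b *\<^sub>R b"
      have "inner (v - ?w) b = 0" if "b \<in> M" for b
      proof -
        have "inner ?w b = (\<Sum>c\<in>M. if c = b then inner v b else 0)"
          unfolding inner_sum_left
          using M that by (intro sum.cong) (auto simp: orthonormal_set_def)
        then show ?thesis using fin that by (simp add: inner_diff_left)
      qed
      then have "v - ?w = 0" by (rule max)
      moreover have "?w \<in> span M" by (intro span_sum span_mul span_base)
      ultimately show ?thesis by simp
    qed
    then have "UNIV \<subseteq> span M" by blast
    with assms(1) fin show False unfolding infinite_dimensional_def by blast
  qed
  with countable_orthonormal_set[OF assms(2) M] have bij: "bij_betw (from_nat_into M) UNIV M"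
    by (rule bij_betw_from_nat_into)
  have "complete_orthonormal_sequence (from_nat_into M)"
  proof
    show "inner (from_nat_into M i) (from_nat_into M j) = (if i = j then 1 else 0)" for i j
    proof -
      have "from_nat_into M i \<in> M" "from_nat_into M j \<in> M"
        using bij by (auto simp: bij_betw_def)
      moreover have "from_nat_into M i = from_nat_into M j \<longleftrightarrow> i = j"
        using bij by (auto simp: bij_betw_def inj_def)
      ultimately show ?thesis using M by (simp add: orthonormal_set_def)
    qed
    show "v = 0" if v: "\<And>i. inner v (from_nat_into M i) = 0" for v
    proof (rule max)
      fix b assume "b \<in> M"
      then obtain i where "b = from_nat_into M i" using bij by (metis bij_betw_iff_bijections)
      then show "inner v b = 0" using v by simp
    qed
  qed
  then show ?thesis by blast
qed

section \<open>Weak topology and coordinates of the frustum\<close>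

lemma topspace_weak_topology [simp]: "topspace weak_topology = UNIV"
proof -
  have "UNIV \<in> {f -` U | (f :: 'a \<Rightarrow> real) U. bounded_linear f \<and> open U}"
    using bounded_linear_zero open_UNIV by blast
  then show ?thesis unfolding weak_topology_def topology_generated_by_topspace by blast
qed

lemma continuous_map_weak_topology_functional:
  fixes f :: "'a::real_inner \<Rightarrow> real"
  assumes "bounded_linear f"
  shows "continuous_map weak_topology euclidean f"
  unfolding continuous_map_alt
proof safe
  fix U :: "real set" assume "openin euclidean U"
  then have "openin weak_topology (f -` U)"
    unfolding weak_topology_def using assms by (intro topology_generated_by_Basis) auto
  then show "openin weak_topology (f -` U \<inter> topspace weak_topology)" by simp
qed simp

lemma topspace_frustum: "topspace frustum = {(v, r). norm v \<le> r \<and> r \<le> 1}"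
  by (auto simp: frustum_def intro: order_trans[OF norm_ge_zero] order_trans)

text \<open>Coordinates are bounded functionals, hence weakly continuous. Conversely, weak
  continuity of \<open>series\<close> needs checking only on the generating open sets, that is,
  after composition with bounded functionals.\<close>

lemma (in complete_orthonormal_sequence) frustum_homeomorphic:
  "(frustum :: ('a \<times> real) topology) homeomorphic_space top_of_set ell2_frustum"
proof -
  let ?S = "top_of_set ell2_frustum"
  let ?f = "\<lambda>p. (\<lambda>i. inner (fst p) (e i), snd p)" and ?g = "\<lambda>p. (series (fst p), snd p)"
  let ?P = "prod_topology (subtopology weak_topology (cball (0::'a) 1)) (top_of_set {0..1::real})"
  have f_in: "?f p \<in> ell2_frustum" if "p \<in> topspace frustum" for p
    using that coordinates_in_ell2_frustum by (auto simp: topspace_frustum)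
  have fstc: "continuous_map ?P weak_topology fst" 
    using continuous_map_fst continuous_map_into_fulltopology by blast
  have sndc: "continuous_map ?P euclidean snd" 
    using continuous_map_snd continuous_map_into_fulltopology by blast
  have "continuous_map ?P euclidean ?f"
    unfolding prod_topology_euclidean[symmetric] continuous_map_pairwise o_def fst_conv snd_conv
      euclidean_product_topology[symmetric] continuous_map_componentwise_UNIV
    using sndc continuous_map_compose[OF fstc continuous_map_weak_topology_functional[OF bounded_linear_inner_left]]
    by (simp add: o_def)
  then have cf: "continuous_map frustum ?S ?f"
    using f_in by (auto simp: frustum_def continuous_map_in_subtopology continuous_map_from_subtopology)
  have cg1: "continuous_map ?S weak_topology (\<lambda>p. series (fst p))"
    unfolding weak_topology_def
  proof (rule continuous_on_generated_topo)
    fix V assume "V \<in> {f -` U | (f :: 'a \<Rightarrow> real) U. bounded_linear f \<and> open U}"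
    then obtain f :: "'a \<Rightarrow> real" and U where "bounded_linear f" "open U" "V = f -` U" by blast
    then show "openin ?S ((\<lambda>p. series (fst p)) -` V \<inter> topspace ?S)"
      using continuous_openin_preimage_gen[OF continuous_on_series_functional[of f], of U]
      by (simp add: vimage_def Int_def conj_commute)
  next
    show "(\<lambda>p. series (fst p)) ` topspace ?S \<subseteq> \<Union> {f -` U | (f :: 'a \<Rightarrow> real) U. bounded_linear f \<and> open U}"
      using topspace_weak_topology[where 'a = 'a]
      unfolding weak_topology_def topology_generated_by_topspace by (metis subset_UNIV)
  qed
  have g_in: "norm (series a) \<le> r" "norm (series a) \<le> 1" "0 \<le> r" "r \<le> 1"
    if "(a, r) \<in> ell2_frustum" for a r
    using norm_series_le[OF that] ell2_frustumD(1,2)[OF that] by auto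
  have "continuous_map ?S euclidean snd"
    by (simp add: continuous_on_snd)
  then have cg: "continuous_map ?S frustum ?g"
    using cg1 g_in by (auto simp: frustum_def continuous_map_in_subtopology continuous_map_pairwise o_def)
  have "homeomorphic_maps frustum ?S ?f ?g"
    unfolding homeomorphic_maps_def using cf cg
    by (auto simp: series_coordinates inner_series_e ell2_frustumD)
  then show ?thesis unfolding homeomorphic_space_def by blast
qed

section \<open>The horicompactification of the Hilbert space\<close>

text \<open>With \<open>x = v /\<^sub>R s\<close> and \<open>norm v = r\<close>, the distance from
  \<open>x\<close> to \<open>w\<close> is \<open>R w / s\<close>. Expanding
  \<open>(R y - R z) / s\<close> by the conjugate \<open>R y + R z\<close> cancels the factor
  \<open>s\<close>. At \<open>r = 1\<close> what remains is \<open>- inner v (y - z)\<close>, a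
  difference of Busemann functions if \<open>v\<close> is a unit vector.\<close>

definition hilbert_hori :: "'a::real_inner \<Rightarrow> 'a \<Rightarrow> 'a \<Rightarrow> real \<Rightarrow> real" where
  "hilbert_hori y z v r =
     (let s = sqrt (1 - r\<^sup>2); R = \<lambda>w. sqrt (r\<^sup>2 - 2 * s * inner v w + s\<^sup>2 * (norm w)\<^sup>2)
      in (s * ((norm y)\<^sup>2 - (norm z)\<^sup>2) - 2 * inner v (y - z)) / (R y + R z))"

text \<open>Completing the square; \<open>r\<^sup>2 - (norm v)\<^sup>2\<close> is the mass lost in a
  weak limit.\<close>

lemma hilbert_hori_radicand_nonneg:
  assumes "norm v \<le> r"
  shows "(norm (v - s *\<^sub>R w))\<^sup>2 + (r\<^sup>2 - (norm v)\<^sup>2) = r\<^sup>2 - 2 * s * inner v w + s\<^sup>2 * (norm w)\<^sup>2"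
    and "0 \<le> r\<^sup>2 - 2 * s * inner v w + s\<^sup>2 * (norm w)\<^sup>2"
proof -
  show eq: "(norm (v - s *\<^sub>R w))\<^sup>2 + (r\<^sup>2 - (norm v)\<^sup>2) = r\<^sup>2 - 2 * s * inner v w + s\<^sup>2 * (norm w)\<^sup>2"
    by (simp add: power2_norm_eq_inner inner_diff_left inner_diff_right inner_commute[of w v]
        power2_eq_square[of s] algebra_simps)
  have "(norm v)\<^sup>2 \<le> r\<^sup>2" using assms by (simp add: power_mono)
  then have "0 \<le> (norm (v - s *\<^sub>R w))\<^sup>2 + (r\<^sup>2 - (norm v)\<^sup>2)" by simp
  then show "0 \<le> r\<^sup>2 - 2 * s * inner v w + s\<^sup>2 * (norm w)\<^sup>2" unfolding eq .
qed

text \<open>If both roots vanish, then \<open>v = s *\<^sub>R y = s *\<^sub>R z\<close> and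
  \<open>norm v = r\<close>. As \<open>y \<noteq> z\<close>, this forces \<open>s = 0\<close>, hence
  \<open>v = 0\<close> and \<open>r = 0\<close>, which contradicts \<open>s = 1\<close>
  there.\<close>

lemma hilbert_hori_denominator_pos:
  fixes v :: "'a::real_inner"
  assumes "norm v \<le> r" "r \<le> 1" "y \<noteq> z" and s: "s = sqrt (1 - r\<^sup>2)"
  shows "0 < sqrt (r\<^sup>2 - 2 * s * inner v y + s\<^sup>2 * (norm y)\<^sup>2) + sqrt (r\<^sup>2 - 2 * s * inner v z + s\<^sup>2 * (norm z)\<^sup>2)"
proof (rule ccontr)
  note nonneg = hilbert_hori_radicand_nonneg(2)[OF assms(1), of s]
  note eq = hilbert_hori_radicand_nonneg(1)[OF assms(1), of s]
  assume "\<not> ?thesis"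
  then have "sqrt (r\<^sup>2 - 2 * s * inner v y + s\<^sup>2 * (norm y)\<^sup>2) = 0"
    and "sqrt (r\<^sup>2 - 2 * s * inner v z + s\<^sup>2 * (norm z)\<^sup>2) = 0"
    using real_sqrt_ge_zero[OF nonneg[of y]] real_sqrt_ge_zero[OF nonneg[of z]] by linarith+
  then have "(norm (v - s *\<^sub>R y))\<^sup>2 + (r\<^sup>2 - (norm v)\<^sup>2) = 0" "(norm (v - s *\<^sub>R z))\<^sup>2 + (r\<^sup>2 - (norm v)\<^sup>2) = 0"
    unfolding eq by simp_all
  moreover have "(norm v)\<^sup>2 \<le> r\<^sup>2" using assms(1) by (simp add: power_mono)
  ultimately have "(norm (v - s *\<^sub>R y))\<^sup>2 = 0" "(norm (v - s *\<^sub>R z))\<^sup>2 = 0" and r: "r\<^sup>2 = (norm v)\<^sup>2"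
    using zero_le_power2[of "norm (v - s *\<^sub>R y)"] zero_le_power2[of "norm (v - s *\<^sub>R z)"] by linarith+
  then have v: "v = s *\<^sub>R y" "v = s *\<^sub>R z" by simp_all
  with \<open>y \<noteq> z\<close> have "s = 0" by auto
  with v(1) r have "r\<^sup>2 = 0" by simp
  then have "s = 1" by (simp add: s)
  with \<open>s = 0\<close> show False by simp
qed

text \<open>Undoes the rationalization. With the factor \<open>s\<close> on the left the identity
  also makes sense at \<open>s = 0\<close>.\<close>

lemma hilbert_hori_conjugate:
  assumes "norm v \<le> r" "r \<le> 1" "y \<noteq> z"
  defines "s \<equiv> sqrt (1 - r\<^sup>2)"
  shows "s * hilbert_hori y z v r =
    sqrt (r\<^sup>2 - 2 * s * inner v y + s\<^sup>2 * (norm y)\<^sup>2) - sqrt (r\<^sup>2 - 2 * s * inner v z + s\<^sup>2 * (norm z)\<^sup>2)"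
    (is "_ = ?A - ?B")
proof -
  have pos: "0 < ?A + ?B"
    using hilbert_hori_denominator_pos[OF assms(1-3)] by (simp add: s_def)
  have "(?A - ?B) * (?A + ?B) = ?A\<^sup>2 - ?B\<^sup>2" by (simp add: power2_eq_square algebra_simps)
  also have "\<dots> = s * (s * ((norm y)\<^sup>2 - (norm z)\<^sup>2) - 2 * inner v (y - z))"
    unfolding real_sqrt_pow2[OF hilbert_hori_radicand_nonneg(2)[OF assms(1)]]
    by (simp add: inner_diff_right power2_eq_square[of s] algebra_simps)
  finally have "(?A - ?B) * (?A + ?B) = s * hilbert_hori y z v r * (?A + ?B)"
    using pos by (simp add: hilbert_hori_def Let_def flip: s_def)
  then show ?thesis using pos by simp
qed

lemma hilbert_hori_eq_dist:
  assumes "norm v = r" "r < 1" "y \<noteq> z"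
  shows "hilbert_hori y z v r =
    dist (v /\<^sub>R sqrt (1 - r\<^sup>2)) y - dist (v /\<^sub>R sqrt (1 - r\<^sup>2)) z"
proof -
  define s where "s = sqrt (1 - r\<^sup>2)"
  have "r\<^sup>2 < 1" using assms(1,2) by (metis abs_norm_cancel abs_square_less_1)
  then have "s > 0" by (simp add: s_def)
  have "sqrt (r\<^sup>2 - 2 * s * inner v w + s\<^sup>2 * (norm w)\<^sup>2) = s * dist (v /\<^sub>R s) w" for w
  proof -
    have "sqrt (r\<^sup>2 - 2 * s * inner v w + s\<^sup>2 * (norm w)\<^sup>2) = norm (v - s *\<^sub>R w)"
      using hilbert_hori_radicand_nonneg(1)[of v r s w] assms(1) by (metis add_0_right diff_self norm_ge_zero order_refl real_sqrt_unique)
    also have "v - s *\<^sub>R w = s *\<^sub>R (v /\<^sub>R s - w)" using \<open>s > 0\<close> by (simp add: scaleR_diff_right)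
    finally show ?thesis using \<open>s > 0\<close> by (simp add: dist_norm)
  qed
  then have "s * hilbert_hori y z v r = s * (dist (v /\<^sub>R s) y - dist (v /\<^sub>R s) z)"
    using hilbert_hori_conjugate[of v r y z] assms by (simp add: s_def right_diff_distrib)
  then show ?thesis using \<open>s > 0\<close> by (simp flip: s_def)
qed

text \<open>The square of this quotient is the injective function \<open>(1 - t) / (1 + t)\<close>.
  It occurs as the limit that detects the radius.\<close>

lemma sqrt_div_one_plus_inj:
  fixes r q :: real
  assumes "0 \<le> r" "r \<le> 1" "0 \<le> q" "q \<le> 1"
    and "sqrt (1 - r\<^sup>2) / (1 + r) = sqrt (1 - q\<^sup>2) / (1 + q)"
  shows "r = q"
proof -
  have *: "(sqrt (1 - t\<^sup>2) / (1 + t))\<^sup>2 = (1 - t) / (1 + t)" if "0 \<le> t" "t \<le> 1" for t :: real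
  proof -
    have "1 - t\<^sup>2 = (1 - t) * (1 + t)" by (simp add: power2_eq_square algebra_simps)
    moreover have "t\<^sup>2 \<le> 1" using that by (simp add: power_le_one)
    ultimately have "(sqrt (1 - t\<^sup>2) / (1 + t))\<^sup>2 = ((1 - t) * (1 + t)) / ((1 + t) * (1 + t))"
      by (simp add: power_divide flip: power2_eq_square)
    also have "\<dots> = (1 - t) / (1 + t)" using that by simp
    finally show ?thesis .
  qed
  have "(1 - r) / (1 + r) = (1 - q) / (1 + q)"
    using *[of r] *[of q] assms by metis
  then show ?thesis using assms(1,3) by (simp add: field_simps)
qed

context complete_orthonormal_sequence
begin

text \<open>Since \<open>r\<^sup>2 + s\<^sup>2 = 1\<close>, the two roots are
  \<open>sqrt (1 - 2 * s * a n)\<close> and \<open>r\<close>, and \<open>a n\<close> tends to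
  0.\<close>

lemma hilbert_hori_tendsto:
  assumes "(a, r) \<in> ell2_frustum"
  shows "(\<lambda>n. hilbert_hori (e n) 0 (series a) r) \<longlonglongrightarrow> sqrt (1 - r\<^sup>2) / (1 + r)"
proof -
  note D = ell2_frustumD[OF assms]
  note a0 = ell2_frustum_tendsto_zero[OF assms]
  define s where "s = sqrt (1 - r\<^sup>2)"
  have ss: "s\<^sup>2 = 1 - r\<^sup>2" using D(1,2) by (simp add: s_def power_le_one)
  have "(\<lambda>n. (s - 2 * a n) / (sqrt (1 - 2 * s * a n) + r)) \<longlonglongrightarrow> (s - 2 * 0) / (sqrt (1 - 2 * s * 0) + r)"
    using D(1) by (intro tendsto_intros a0) simp
  moreover have "hilbert_hori (e n) 0 (series a) r = (s - 2 * a n) / (sqrt (1 - 2 * s * a n) + r)" for n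
    using D(1) by (simp add: hilbert_hori_def Let_def inner_series_e D(4) norm_eq_1 ss flip: s_def)
  ultimately show ?thesis by (simp add: s_def)
qed

lemma hilbert_hori_inj:
  assumes p: "(a, r) \<in> ell2_frustum" and q: "(b, t) \<in> ell2_frustum"
    and eq: "\<And>y z. y \<noteq> z \<Longrightarrow> hilbert_hori y z (series a) r = hilbert_hori y z (series b) t"
  shows "(a, r) = (b, t)"
proof -
  note P = ell2_frustumD[OF p] and Q = ell2_frustumD[OF q]
  have "e n \<noteq> 0" for n using norm_eq_1[of n] by auto
  then have "(\<lambda>n. hilbert_hori (e n) 0 (series a) r) = (\<lambda>n. hilbert_hori (e n) 0 (series b) t)"
    using eq by presburger
  then have "sqrt (1 - r\<^sup>2) / (1 + r) = sqrt (1 - t\<^sup>2) / (1 + t)"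
    using hilbert_hori_tendsto[OF p] hilbert_hori_tendsto[OF q] by (simp add: LIMSEQ_unique)
  then have "r = t" by (rule sqrt_div_one_plus_inj[OF P(1,2) Q(1,2)])
  define s where "s = sqrt (1 - r\<^sup>2)"
  have "a i = b i" for i
  \<comment> \<open>At \<open>s = 0\<close> the value at \<open>e i\<close> and \<open>0\<close> is
    \<open>- a i\<close>. Otherwise the roots at \<open>0\<close> agree, so those at
    \<open>e i\<close> do, and their radicands are linear in the coordinate with slope
    \<open>- 2 * s\<close>.\<close>
  proof (cases "s = 0")
    case True
    then have "r\<^sup>2 = 1" by (simp add: s_def)
    then have "r = 1" using P(1) by (simp add: power2_eq_1_iff)
    with True \<open>r = t\<close> show ?thesis
      using eq[OF \<open>e i \<noteq> 0\<close>] by (simp add: hilbert_hori_def Let_def inner_series_e P(4) Q(4))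
  next
    case False
    have "sqrt (r\<^sup>2 - 2 * s * inner (series a) (e i) + s\<^sup>2 * (norm (e i))\<^sup>2)
        = sqrt (r\<^sup>2 - 2 * s * inner (series b) (e i) + s\<^sup>2 * (norm (e i))\<^sup>2)"
      using hilbert_hori_conjugate[OF norm_series_le[OF p] P(2) \<open>e i \<noteq> 0\<close>]
        hilbert_hori_conjugate[OF norm_series_le[OF q] Q(2) \<open>e i \<noteq> 0\<close>]
        eq[OF \<open>e i \<noteq> 0\<close>] \<open>r = t\<close> by (auto simp: s_def)
    then show ?thesis using False by (simp add: inner_series_e P(4) Q(4))
  qed
  with \<open>r = t\<close> show ?thesis by auto
qed

lemma continuous_on_hilbert_hori:
  assumes "y \<noteq> z"
  shows "continuous_on ell2_frustum (\<lambda>p. hilbert_hori y z (series (fst p)) (snd p))"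
proof -
  have nz: "sqrt ((snd p)\<^sup>2 - 2 * sqrt (1 - (snd p)\<^sup>2) * inner (series (fst p)) y + (sqrt (1 - (snd p)\<^sup>2))\<^sup>2 * (norm y)\<^sup>2)
    + sqrt ((snd p)\<^sup>2 - 2 * sqrt (1 - (snd p)\<^sup>2) * inner (series (fst p)) z + (sqrt (1 - (snd p)\<^sup>2))\<^sup>2 * (norm z)\<^sup>2) \<noteq> 0"
    if "p \<in> ell2_frustum" for p
    using hilbert_hori_denominator_pos[OF norm_series_le[of "fst p" "snd p"] _ assms refl]
      ell2_frustumD(2)[of "fst p" "snd p"] that by fastforce
  show ?thesis
    unfolding hilbert_hori_def Let_def
    by (intro continuous_on_divide continuous_on_add continuous_on_diff continuous_on_mult
        continuous_on_real_sqrt continuous_on_const continuous_on_power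
        continuous_on_snd[OF continuous_on_id] continuous_on_inner_series ballI nz)
qed

lemma hilbert_horicompactification:
  "horicompactification (UNIV :: 'a set) dist homeomorphic_space top_of_set ell2_frustum"
proof (rule horicompactification_homeomorphic_compact
    [where \<Phi> = "\<lambda>y z p. hilbert_hori y z (series (fst p)) (snd p)", OF compact_ell2_frustum
      ell2_frustum_side_subset ell2_frustum_subset_closure_side])
  show "\<bar>dist x y - dist x z\<bar> \<le> dist y z" for x y z :: 'a
    using dist_triangle[of x y z] dist_triangle[of x z y] by (simp add: dist_commute)
  show "continuous_on ell2_frustum (\<lambda>p. hilbert_hori y z (series (fst p)) (snd p))"
    if "y \<noteq> z" for y z
    by (rule continuous_on_hilbert_hori[OF that])
  show "p = q" if "p \<in> ell2_frustum" "q \<in> ell2_frustum"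
    "\<And>y z. \<lbrakk>y \<in> UNIV; z \<in> UNIV; y \<noteq> z\<rbrakk> \<Longrightarrow>
      hilbert_hori y z (series (fst p)) (snd p) = hilbert_hori y z (series (fst q)) (snd q)" for p q
    using hilbert_hori_inj[of "fst p" "snd p" "fst q" "snd q"] that by simp
  show "\<exists>q\<in>ell2_frustum. \<forall>y\<in>UNIV. \<forall>z\<in>UNIV. y \<noteq> z \<longrightarrow>
      hilbert_hori y z (series (fst q)) (snd q) = dist x y - dist x z" for x
  proof -
    \<comment> \<open>Inverts the scaling \<open>v /\<^sub>R s\<close>: here
      \<open>1 - (norm v)\<^sup>2\<close> is \<open>1 / c\<^sup>2\<close>, so
      \<open>s = 1 / c\<close>.\<close>
    define c where "c = sqrt (1 + (norm x)\<^sup>2)"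
    define v where "v = x /\<^sub>R c"
    have c2: "c\<^sup>2 = 1 + (norm x)\<^sup>2" by (simp add: c_def)
    have "c > 0" by (simp add: c_def add_pos_nonneg)
    have "(norm v)\<^sup>2 = (norm x)\<^sup>2 / c\<^sup>2"
      by (simp add: v_def power_mult_distrib power_inverse divide_inverse mult.commute)
    also have "\<dots> = 1 - 1 / c\<^sup>2"
    proof -
      have "1 + (norm x)\<^sup>2 \<noteq> 0" by (smt (verit) zero_le_power2)
      then show ?thesis by (simp add: c2 divide_simps)
    qed
    finally have v2: "1 - (norm v)\<^sup>2 = (inverse c)\<^sup>2" by (simp add: power_inverse divide_inverse)
    then have "sqrt (1 - (norm v)\<^sup>2) = inverse c" using \<open>c > 0\<close> by simp
    then have x: "v /\<^sub>R sqrt (1 - (norm v)\<^sup>2) = x" using \<open>c > 0\<close> by (simp add: v_def)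
    have "(norm v)\<^sup>2 < 1" using v2 \<open>c > 0\<close> by (smt (verit) zero_less_power inverse_positive_iff_positive)
    then have v1: "norm v < 1" by (simp add: abs_square_less_1)
    have "hilbert_hori y z v (norm v) = dist x y - dist x z" if "y \<noteq> z" for y z
      using hilbert_hori_eq_dist[OF refl v1 that] unfolding x .
    then show ?thesis
      using v1 by (intro bexI[of _ "(\<lambda>i. inner v (e i), norm v)"] coordinates_in_ell2_frustum)
        (simp_all add: series_coordinates)
  qed
  show "\<exists>x\<in>UNIV. \<forall>y\<in>UNIV. \<forall>z\<in>UNIV. y \<noteq> z \<longrightarrow>
      hilbert_hori y z (series (fst q)) (snd q) = dist x y - dist x z" if "q \<in> ell2_frustum_side" for q
  proof -
    have "norm (series (fst q)) = snd q" using norm_series_side[of "fst q" "snd q"] that by simp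
    moreover have "snd q < 1" using that by (auto simp: ell2_frustum_side_def)
    ultimately show ?thesis using hilbert_hori_eq_dist by blast
  qed
qed

end

section \<open>The horicompactification of the hyperbolic space\<close>

text \<open>For \<open>s = sqrt (1 - r\<^sup>2)\<close> and \<open>0 < s \<le> A\<close> this is
  \<open>arcosh (A / s) + ln s\<close>. Unlike the two summands it stays finite at
  \<open>s = 0\<close>, where it is \<open>ln (2 * A)\<close> for positive \<open>A\<close>.\<close>

definition horo_log :: "real \<Rightarrow> real \<Rightarrow> real" where
  "horo_log A r = ln (A + sqrt (A\<^sup>2 - (1 - r\<^sup>2)))"

lemma arcosh_scaled:
  assumes "0 < s" "s \<le> A" "s\<^sup>2 = 1 - r\<^sup>2"
  shows "arcosh (A / s) = horo_log A r - ln s"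
proof -
  have "(A / s)\<^sup>2 - 1 = (A\<^sup>2 - s\<^sup>2) / s\<^sup>2" using assms(1) by (simp add: power_divide field_simps)
  then have "sqrt ((A / s)\<^sup>2 - 1) = sqrt (A\<^sup>2 - s\<^sup>2) / s" using assms(1) by (simp add: real_sqrt_divide)
  moreover have "1 \<le> A / s" using assms(1,2) by simp
  ultimately have "arcosh (A / s) = ln ((A + sqrt (A\<^sup>2 - s\<^sup>2)) / s)"
    by (simp add: arcosh_real_def add_divide_distrib)
  also have "A + sqrt (A\<^sup>2 - s\<^sup>2) > 0"
    using assms(1,2) power_mono[OF assms(2), of 2] by (intro add_pos_nonneg) auto
  then have "ln ((A + sqrt (A\<^sup>2 - s\<^sup>2)) / s) = ln (A + sqrt (A\<^sup>2 - s\<^sup>2)) - ln s"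
    using assms(1) by (simp add: ln_div)
  finally show ?thesis by (simp add: horo_log_def assms(3))
qed

lemma horo_log_inj:
  assumes "0 < A" "1 - r\<^sup>2 \<le> A\<^sup>2" "0 < B" "1 - r\<^sup>2 \<le> B\<^sup>2" "horo_log A r = horo_log B r"
  shows "A = B"
proof -
  let ?h = "\<lambda>A. A + sqrt (A\<^sup>2 - (1 - r\<^sup>2))"
  have mono: "?h A < ?h B" if "A < B" "0 < A" for A B
  proof -
    have "A\<^sup>2 \<le> B\<^sup>2" using that by (intro power_mono) auto
    then have "sqrt (A\<^sup>2 - (1 - r\<^sup>2)) \<le> sqrt (B\<^sup>2 - (1 - r\<^sup>2))" by simp
    then show ?thesis using that by linarith
  qed
  have "0 < ?h A" "0 < ?h B" using assms(1-4) by (auto intro!: add_pos_nonneg)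
  then have "?h A = ?h B" using assms(5) by (simp add: horo_log_def)
  then show ?thesis using mono[of A B] mono[of B A] assms(1,3) by linarith
qed

text \<open>The quotient is strictly decreasing on the unit interval: its part with
  \<open>sqrt 2\<close> strictly, the other part weakly. The latter follows by cross-multiplying and
  comparing squares.\<close>

lemma sqrt2_quotient_inj:
  fixes r q :: real
  assumes "0 \<le> r" "r \<le> 1" "0 \<le> q" "q \<le> 1"
    and "(sqrt 2 + sqrt (1 + r\<^sup>2)) / (1 + r) = (sqrt 2 + sqrt (1 + q\<^sup>2)) / (1 + q)"
  shows "r = q"
proof -
  have less: "(sqrt 2 + sqrt (1 + q\<^sup>2)) / (1 + q) < (sqrt 2 + sqrt (1 + r\<^sup>2)) / (1 + r)"
    if "0 \<le> r" "r < q" "q \<le> 1" for r q :: real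
  proof -
    have "(1 + q\<^sup>2) * (1 + r)\<^sup>2 - (1 + r\<^sup>2) * (1 + q)\<^sup>2 = 2 * (r - q) * (1 - r * q)"
      by (simp add: power2_eq_square algebra_simps)
    also have "\<dots> \<le> 0"
      using that mult_mono[of r 1 q 1] by (intro mult_nonpos_nonneg[of "2 * (r - q)"]) auto
    finally have "sqrt ((1 + q\<^sup>2) * (1 + r)\<^sup>2) \<le> sqrt ((1 + r\<^sup>2) * (1 + q)\<^sup>2)" by simp
    then have "sqrt (1 + q\<^sup>2) * (1 + r) \<le> sqrt (1 + r\<^sup>2) * (1 + q)"
      using that by (simp add: real_sqrt_mult)
    moreover have "sqrt 2 * (1 + r) < sqrt 2 * (1 + q)" using that by simp
    ultimately have "(sqrt 2 + sqrt (1 + q\<^sup>2)) * (1 + r) < (sqrt 2 + sqrt (1 + r\<^sup>2)) * (1 + q)"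
      unfolding distrib_right[of "sqrt 2"] by (intro add_less_le_mono)
    then show ?thesis using that by (simp add: divide_simps)
  qed
  then show ?thesis
    using less[of r q] less[of q r] assms by linarith
qed

section \<open>Lorentz form and hyperbolic metric\<close>

context complete_orthonormal_sequence
begin

text \<open>The shift leaves out the time direction \<open>e 0\<close>, so this sequence is
  orthonormal but not complete.\<close>

sublocale spatial: orthonormal_sequence "\<lambda>i. e (Suc i)"
  by unfold_locales (simp add: inner_eq)

text \<open>Parseval's identity removes the infinite sum.\<close>

lemma lorentz_Q_eq: "lorentz_Q e x = 2 * (inner x (e 0))\<^sup>2 - inner x x"
  using suminf_split_head[OF summable_coordinates[of x]] Parseval[of x]
  by (simp add: lorentz_Q_def power2_norm_eq_inner)

lemma lorentz_form_eq: "lorentz_form e x y = 2 * inner x (e 0) * inner y (e 0) - inner x y"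
  by (simp add: lorentz_form_def lorentz_Q_eq inner_add_left inner_add_right
      inner_commute[of y x] power2_eq_square field_simps)

lemma lorentz_form_bilinear:
  "lorentz_form e (x + y) z = lorentz_form e x z + lorentz_form e y z"
  "lorentz_form e (x - y) z = lorentz_form e x z - lorentz_form e y z"
  "lorentz_form e (c *\<^sub>R x) z = c * lorentz_form e x z"
  "lorentz_form e z (x + y) = lorentz_form e z x + lorentz_form e z y"
  "lorentz_form e z (x - y) = lorentz_form e z x - lorentz_form e z y"
  "lorentz_form e z (c *\<^sub>R x) = c * lorentz_form e z x"
  by (simp_all add: lorentz_form_eq inner_add_left inner_add_right inner_diff_left inner_diff_right
      algebra_simps)

lemma lorentz_form_commute: "lorentz_form e x y = lorentz_form e y x"
  by (simp add: lorentz_form_eq inner_commute)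

lemma hyperbolic_space_iff: "x \<in> hyperbolic_space e \<longleftrightarrow> lorentz_form e x x = 1 \<and> 0 < inner x (e 0)"
  by (simp add: hyperbolic_space_def lorentz_Q_eq lorentz_form_eq power2_eq_square mult.assoc)

lemma hyperbolic_space_norm:
  assumes "x \<in> hyperbolic_space e"
  shows "(norm x)\<^sup>2 = 2 * (inner x (e 0))\<^sup>2 - 1" "0 < inner x (e 0)"
  using assms by (auto simp: hyperbolic_space_def lorentz_Q_eq power2_norm_eq_inner)

text \<open>Orthogonality says that \<open>2 * inner u (e 0) * inner z (e 0)\<close> equals
  \<open>inner u z\<close>. Square, apply Cauchy-Schwarz and
  \<open>(norm z)\<^sup>2 \<le> 2 * (inner z (e 0))\<^sup>2\<close>, and cancel.\<close>

lemma lorentz_form_nonpos_orthogonal: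
  assumes "z \<in> hyperbolic_space e" "lorentz_form e u z = 0"
  shows "lorentz_form e u u \<le> 0"
proof -
  note z = hyperbolic_space_norm[OF assms(1)]
  have "(2 * inner u (e 0) * inner z (e 0))\<^sup>2 = (inner u z)\<^sup>2"
    using assms(2) by (simp add: lorentz_form_eq)
  also have "\<dots> \<le> (norm u)\<^sup>2 * (norm z)\<^sup>2"
    using Cauchy_Schwarz_ineq[of u z] by (simp add: power2_norm_eq_inner)
  also have "\<dots> \<le> (norm u)\<^sup>2 * (2 * (inner z (e 0))\<^sup>2)"
    by (intro mult_left_mono) (simp_all add: z)
  finally have "(2 * (inner u (e 0))\<^sup>2) * (2 * (inner z (e 0))\<^sup>2) \<le> (norm u)\<^sup>2 * (2 * (inner z (e 0))\<^sup>2)"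
    by (simp add: power_mult_distrib algebra_simps)
  then have "2 * (inner u (e 0))\<^sup>2 \<le> (norm u)\<^sup>2"
    using z(2) by (simp only: mult_le_cancel_right) (simp add: not_less)
  then show ?thesis by (simp add: lorentz_form_eq power2_norm_eq_inner) (simp add: power2_eq_square)
qed

text \<open>Cauchy-Schwarz for the negated form, which is positive semidefinite on the orthogonal
  complement of \<open>z\<close>.\<close>

lemma lorentz_form_Cauchy_Schwarz:
  assumes "z \<in> hyperbolic_space e" "lorentz_form e u z = 0" "lorentz_form e w z = 0"
  shows "(lorentz_form e u w)\<^sup>2 \<le> lorentz_form e u u * lorentz_form e w w"
proof -
  let ?B = "lorentz_form e" and ?\<alpha> = "- lorentz_form e w w" and ?\<beta> = "lorentz_form e u w"
  have neg: "a * a * ?B u u + 2 * a * b * ?B u w + b * b * ?B w w \<le> 0" for a b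
    using lorentz_form_nonpos_orthogonal[OF assms(1), of "a *\<^sub>R u + b *\<^sub>R w"] assms(2,3)
    by (simp add: lorentz_form_bilinear lorentz_form_commute[of w u] algebra_simps)
  show ?thesis
  proof (cases "?\<alpha> = 0")
    case True
    have "?\<beta> = 0"
    proof (rule ccontr)
      assume "?\<beta> \<noteq> 0"
      then show False
        \<comment> \<open>In the degenerate case the quadratic is affine in \<open>b\<close>; this
          choice gives it the value 1.\<close>
        using neg[of 1 "(1 - ?B u u) / (2 * ?\<beta>)"] True by (simp add: field_simps)
    qed
    with True show ?thesis by simp
  next
    case False
    then have "?\<alpha> > 0" using lorentz_form_nonpos_orthogonal[OF assms(1,3)] by simp
    moreover have "?\<alpha> * (?\<alpha> * ?B u u + ?\<beta>\<^sup>2) \<le> 0"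
      using neg[of ?\<alpha> ?\<beta>] by (simp add: power2_eq_square algebra_simps)
    ultimately have "?\<alpha> * ?B u u + ?\<beta>\<^sup>2 \<le> 0" by (meson mult_pos_pos not_le)
    then show ?thesis by (simp add: algebra_simps)
  qed
qed

text \<open>The component of \<open>x\<close> orthogonal to \<open>y\<close> has form
  \<open>1 - (?B x y)\<^sup>2\<close>, which is nonpositive. The sign of \<open>?B x y\<close> comes
  from \<open>(norm x)\<^sup>2 < 2 * (inner x (e 0))\<^sup>2\<close>, the same for \<open>y\<close>,
  and Cauchy-Schwarz.\<close>

lemma lorentz_form_ge_1:
  assumes x: "x \<in> hyperbolic_space e" and y: "y \<in> hyperbolic_space e"
  shows "1 \<le> lorentz_form e x y"
proof -
  let ?B = "lorentz_form e"
  note X = hyperbolic_space_norm[OF x] and Y = hyperbolic_space_norm[OF y]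
  have one: "?B x x = 1" "?B y y = 1" using x y by (auto simp: hyperbolic_space_iff)
  have "?B (x - ?B x y *\<^sub>R y) (x - ?B x y *\<^sub>R y) \<le> 0"
    by (rule lorentz_form_nonpos_orthogonal[OF y]) (simp add: lorentz_form_bilinear one)
  then have "1 \<le> (?B x y)\<^sup>2"
    by (simp add: lorentz_form_bilinear one lorentz_form_commute[of y x] power2_eq_square)
  moreover have "0 < ?B x y"
  proof -
    have "(norm x * norm y)\<^sup>2 < (2 * inner x (e 0) * inner y (e 0))\<^sup>2"
    proof -
      have "(norm x)\<^sup>2 * (norm y)\<^sup>2 < (2 * (inner x (e 0))\<^sup>2) * (2 * (inner y (e 0))\<^sup>2)"
        by (rule mult_strict_mono) (use X Y zero_le_power2[of "norm y"] in auto)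
      then show ?thesis by (simp add: power_mult_distrib)
    qed
    then have "norm x * norm y < 2 * inner x (e 0) * inner y (e 0)"
      using X(2) Y(2) by (intro power_less_imp_less_base[of "norm x * norm y" 2]) auto
    then show ?thesis using norm_cauchy_schwarz[of x y] by (simp add: lorentz_form_eq)
  qed
  ultimately show ?thesis using abs_le_square_iff[of 1 "?B x y"] by simp
qed

text \<open>Cauchy-Schwarz for the components of \<open>x\<close> and \<open>y\<close> orthogonal to
  \<open>z\<close> bounds \<open>?B x y\<close> by the addition formula for \<open>cosh\<close> of
  the sum of the two distances.\<close>

lemma hyperbolic_dist_triangle:
  assumes x: "x \<in> hyperbolic_space e" and y: "y \<in> hyperbolic_space e" and z: "z \<in> hyperbolic_space e"
  shows "hyperbolic_dist e x y \<le> hyperbolic_dist e x z + hyperbolic_dist e z y"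
proof -
  let ?B = "lorentz_form e"
  let ?b = "?B x z" and ?c = "?B z y"
  note ge = lorentz_form_ge_1[OF x y] lorentz_form_ge_1[OF x z] lorentz_form_ge_1[OF z y]
  have one: "?B x x = 1" "?B y y = 1" "?B z z = 1" using x y z by (auto simp: hyperbolic_space_iff)
  have "(?B (x - ?b *\<^sub>R z) (y - ?c *\<^sub>R z))\<^sup>2
      \<le> ?B (x - ?b *\<^sub>R z) (x - ?b *\<^sub>R z) * ?B (y - ?c *\<^sub>R z) (y - ?c *\<^sub>R z)"
    by (rule lorentz_form_Cauchy_Schwarz[OF z])
       (simp_all add: lorentz_form_bilinear one lorentz_form_commute[of y z])
  then have "(?B x y - ?b * ?c)\<^sup>2 \<le> (?b\<^sup>2 - 1) * (?c\<^sup>2 - 1)"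
    by (simp add: lorentz_form_bilinear one lorentz_form_commute[of z x] lorentz_form_commute[of y z]
        power2_eq_square algebra_simps)
  then have "?B x y - ?b * ?c \<le> sqrt (?b\<^sup>2 - 1) * sqrt (?c\<^sup>2 - 1)"
    by (simp add: real_le_rsqrt flip: real_sqrt_mult)
  then have "?B x y \<le> cosh (arcosh ?b + arcosh ?c)"
    using ge by (simp add: cosh_add sinh_arcosh_real)
  then have "arcosh (?B x y) \<le> arcosh (cosh (arcosh ?b + arcosh ?c))"
    using ge cosh_real_ge_1 arcosh_less_iff_real by (meson not_le)
  then show ?thesis using ge by (simp add: hyperbolic_dist_def arcosh_cosh_real)
qed

section \<open>Klein model and extension of the distance differences\<close>

lemma inner_spatial_series_e0:
  assumes "(a, r) \<in> ell2_frustum"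
  shows "inner (spatial.series a) (e 0) = 0"
  by (simp add: spatial.inner_series ell2_frustumD[OF assms] inner_eq)

text \<open>The reversed Cauchy-Schwarz inequality of the Lorentz form, applied to \<open>y\<close> and to the
  causal vector \<open>e 0 + v\<close>.\<close>

lemma horo_argument:
  assumes "norm v \<le> r" "r \<le> 1" "inner v (e 0) = 0" "y \<in> hyperbolic_space e"
  defines "A \<equiv> inner y (e 0) - inner v y"
  shows "0 < A" "1 - r\<^sup>2 \<le> A\<^sup>2"
proof -
  note y = hyperbolic_space_norm[OF assms(4)]
  have "0 \<le> r" using assms(1) norm_ge_zero[of v] by linarith
  \<comment> \<open>Time coordinate of \<open>y\<close> and norm of its spatial part;
    \<open>v\<close> pairs only with the latter.\<close>
  define c \<rho> where "c = inner y (e 0)" and "\<rho> = norm (y - inner y (e 0) *\<^sub>R e 0)"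
  have "\<rho>\<^sup>2 = c\<^sup>2 - 1"
    using y(1) by (simp add: \<rho>_def c_def power2_norm_eq_inner inner_diff_left inner_diff_right
        inner_eq inner_commute[of "e 0"]) (simp add: power2_eq_square)
  have "0 < c" "0 \<le> \<rho>" using y(2) by (simp_all add: c_def \<rho>_def)
  then have "\<rho> < c" using \<open>\<rho>\<^sup>2 = c\<^sup>2 - 1\<close> by (intro power_less_imp_less_base[of \<rho> 2 c]) auto
  have "inner v y = inner v (y - inner y (e 0) *\<^sub>R e 0)"
    using assms(3) by (simp add: inner_diff_right)
  also have "\<dots> \<le> norm v * \<rho>" unfolding \<rho>_def by (rule norm_cauchy_schwarz)
  also have "\<dots> \<le> r * \<rho>" using assms(1) \<open>0 \<le> \<rho>\<close> by (rule mult_right_mono)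
  finally have A: "c - r * \<rho> \<le> A" by (simp add: A_def c_def)
  have "r * \<rho> \<le> \<rho>" using assms(2) \<open>0 \<le> \<rho>\<close> by (simp add: mult_left_le_one_le \<open>0 \<le> r\<close>)
  then have pos: "0 < c - r * \<rho>" using \<open>\<rho> < c\<close> by linarith
  then show "0 < A" using A by linarith
  \<comment> \<open>Reversed Cauchy-Schwarz for the plane vectors with coordinates 1,
    \<open>r\<close> and \<open>c\<close>, \<open>\<rho>\<close>, as an identity.\<close>
  have "(c - r * \<rho>)\<^sup>2 = (1 - r\<^sup>2) * (c\<^sup>2 - \<rho>\<^sup>2) + (\<rho> - r * c)\<^sup>2"
    by (simp add: power2_eq_square algebra_simps)
  also have "\<dots> \<ge> 1 - r\<^sup>2" by (simp add: \<open>\<rho>\<^sup>2 = c\<^sup>2 - 1\<close>)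
  finally have "1 - r\<^sup>2 \<le> (c - r * \<rho>)\<^sup>2" .
  also have "\<dots> \<le> A\<^sup>2" using A pos by (intro power_mono) auto
  finally show "1 - r\<^sup>2 \<le> A\<^sup>2" .
qed

text \<open>For \<open>v\<close> orthogonal to \<open>e 0\<close> the arguments of
  \<open>horo_log\<close> are the Lorentz forms of \<open>e 0 + v\<close> with \<open>y\<close> and
  \<open>z\<close>.\<close>

definition hyperbolic_hori :: "'a \<Rightarrow> 'a \<Rightarrow> 'a \<Rightarrow> real \<Rightarrow> real" where
  "hyperbolic_hori y z v r =
     horo_log (inner y (e 0) - inner v y) r - horo_log (inner z (e 0) - inner v z) r"

text \<open>\<open>v\<close> is the point of the Klein model that represents the vector \<open>x\<close> of the hyperboloid.\<close>

lemma hyperbolic_hori_eq_dist: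
  assumes "inner v (e 0) = 0" "norm v = r" "r < 1"
  defines "x \<equiv> (e 0 + v) /\<^sub>R sqrt (1 - r\<^sup>2)"
  shows "x \<in> hyperbolic_space e"
    and "\<And>y z. \<lbrakk>y \<in> hyperbolic_space e; z \<in> hyperbolic_space e\<rbrakk> \<Longrightarrow>
      hyperbolic_hori y z v r = hyperbolic_dist e x y - hyperbolic_dist e x z"
proof -
  define s where "s = sqrt (1 - r\<^sup>2)"
  have "r\<^sup>2 < 1" using assms(2,3) by (metis abs_norm_cancel abs_square_less_1)
  then have "s > 0" and ss: "s\<^sup>2 = 1 - r\<^sup>2" by (simp_all add: s_def)
  have form: "lorentz_form e (e 0 + v) w = inner w (e 0) - inner v w" for w
    using assms(1) by (simp add: lorentz_form_eq inner_add_left inner_eq inner_commute[of "e 0" w])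
  have "lorentz_form e (e 0 + v) (e 0 + v) = s\<^sup>2"
    unfolding form ss using assms(1,2)
    by (simp add: inner_add_left inner_add_right inner_eq norm_eq_1 power2_norm_eq_inner[symmetric])
  moreover have x: "x = inverse s *\<^sub>R (e 0 + v)" by (simp add: x_def s_def)
  ultimately have "lorentz_form e x x = 1"
    using \<open>s > 0\<close> by (simp only: x lorentz_form_bilinear(3,6)) (simp add: power2_eq_square field_simps)
  moreover have "inner x (e 0) = inverse s" using assms(1) by (simp add: x inner_add_left inner_eq)
  ultimately show "x \<in> hyperbolic_space e" using \<open>s > 0\<close> by (simp add: hyperbolic_space_iff)
  \<comment> \<open>The term \<open>ln s\<close> is the same for all \<open>y\<close> and cancels in
    differences.\<close>
  have dist: "hyperbolic_dist e x y = horo_log (inner y (e 0) - inner v y) r - ln s"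
    if y: "y \<in> hyperbolic_space e" for y
  proof -
    let ?A = "inner y (e 0) - inner v y"
    have A: "0 < ?A" "1 - r\<^sup>2 \<le> ?A\<^sup>2" using horo_argument[OF _ _ assms(1) y, of r] assms(2,3) by auto
    then have "s \<le> ?A" using \<open>s > 0\<close> ss by (intro power2_le_imp_le[of s]) auto
    moreover have "lorentz_form e x y = ?A / s"
      by (simp only: x lorentz_form_bilinear(3) form divide_inverse mult.commute)
    ultimately show ?thesis
      unfolding hyperbolic_dist_def using arcosh_scaled[OF \<open>s > 0\<close> _ ss] by simp
  qed
  show "hyperbolic_hori y z v r = hyperbolic_dist e x y - hyperbolic_dist e x z"
    if "y \<in> hyperbolic_space e" "z \<in> hyperbolic_space e" for y z
    using that by (simp add: dist hyperbolic_hori_def)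
qed

lemma e0_in_hyperbolic_space: "e 0 \<in> hyperbolic_space e"
  by (simp add: hyperbolic_space_iff lorentz_form_eq inner_eq)

text \<open>The coefficient \<open>sqrt 2\<close> gives \<open>2 - 1 = 1\<close> for the form.
  Paired with a spatial vector, such a point isolates a single coordinate.\<close>

lemma hyperbolic_test_point:
  "sqrt 2 *\<^sub>R e 0 + e (Suc n) \<in> hyperbolic_space e"
  "sqrt 2 *\<^sub>R e 0 + e (Suc n) \<noteq> e 0"
proof -
  show "sqrt 2 *\<^sub>R e 0 + e (Suc n) \<in> hyperbolic_space e"
    by (simp add: hyperbolic_space_iff lorentz_form_eq inner_add_left inner_add_right inner_eq)
  have "inner (sqrt 2 *\<^sub>R e 0 + e (Suc n)) (e (Suc n)) \<noteq> inner (e 0) (e (Suc n))"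
    by (simp add: inner_add_left inner_eq)
  then show "sqrt 2 *\<^sub>R e 0 + e (Suc n) \<noteq> e 0" by metis
qed

text \<open>At \<open>e 0\<close> the argument is 1, and \<open>horo_log 1 r = ln (1 + r)\<close>
  because \<open>r\<close> is nonnegative.\<close>

lemma hyperbolic_hori_test_point:
  assumes "(a, r) \<in> ell2_frustum"
  shows "hyperbolic_hori (sqrt 2 *\<^sub>R e 0 + e (Suc n)) (e 0) (spatial.series a) r
    = horo_log (sqrt 2 - a n) r - ln (1 + r)"
  using ell2_frustumD(1)[OF assms]
  by (simp add: hyperbolic_hori_def inner_add_left inner_add_right inner_eq
      inner_spatial_series_e0[OF assms] spatial.inner_series_e ell2_frustumD(4)[OF assms] horo_log_def)

lemma hyperbolic_hori_tendsto:
  assumes "(a, r) \<in> ell2_frustum"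
  shows "(\<lambda>n. hyperbolic_hori (sqrt 2 *\<^sub>R e 0 + e (Suc n)) (e 0) (spatial.series a) r)
    \<longlonglongrightarrow> ln ((sqrt 2 + sqrt (1 + r\<^sup>2)) / (1 + r))"
proof -
  note D = ell2_frustumD[OF assms]
  have pos: "0 < sqrt 2 + sqrt (1 + r\<^sup>2)" by (intro add_pos_nonneg) auto
  have "(\<lambda>n. ln (sqrt 2 - a n + sqrt ((sqrt 2 - a n)\<^sup>2 - (1 - r\<^sup>2))) - ln (1 + r))
    \<longlonglongrightarrow> ln (sqrt 2 - 0 + sqrt ((sqrt 2 - 0)\<^sup>2 - (1 - r\<^sup>2))) - ln (1 + r)"
    using pos by (intro tendsto_intros ell2_frustum_tendsto_zero[OF assms]) simp_all
  then show ?thesis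
    using pos D(1) by (simp add: hyperbolic_hori_test_point[OF assms] horo_log_def ln_div)
qed

text \<open>The limit along the test points determines the radius; for a common radius
  \<open>horo_log\<close> is injective, so each test point yields one coordinate.\<close>

lemma hyperbolic_hori_inj:
  assumes p: "(a, r) \<in> ell2_frustum" and q: "(b, t) \<in> ell2_frustum"
    and eq: "\<And>y z. \<lbrakk>y \<in> hyperbolic_space e; z \<in> hyperbolic_space e; y \<noteq> z\<rbrakk> \<Longrightarrow>
      hyperbolic_hori y z (spatial.series a) r = hyperbolic_hori y z (spatial.series b) t"
  shows "(a, r) = (b, t)"
proof -
  note P = ell2_frustumD[OF p] and Q = ell2_frustumD[OF q]
  note test = hyperbolic_test_point
  note eq' = eq[OF test(1) e0_in_hyperbolic_space test(2)]
  have "ln ((sqrt 2 + sqrt (1 + r\<^sup>2)) / (1 + r)) = ln ((sqrt 2 + sqrt (1 + t\<^sup>2)) / (1 + t))"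
    using hyperbolic_hori_tendsto[OF p] hyperbolic_hori_tendsto[OF q] unfolding eq'
    by (rule LIMSEQ_unique)
  moreover have "0 < (sqrt 2 + sqrt (1 + u\<^sup>2)) / (1 + u)" if "0 \<le> u" for u :: real
    using that by (intro divide_pos_pos add_pos_nonneg) auto
  ultimately have "(sqrt 2 + sqrt (1 + r\<^sup>2)) / (1 + r) = (sqrt 2 + sqrt (1 + t\<^sup>2)) / (1 + t)"
    using P(1) Q(1) by (metis ln_inj_iff)
  then have "r = t" by (rule sqrt2_quotient_inj[OF P(1,2) Q(1,2)])
  have "a n = b n" for n
  proof -
    have *: "0 < sqrt 2 - c n" "1 - u\<^sup>2 \<le> (sqrt 2 - c n)\<^sup>2" if c: "(c, u) \<in> ell2_frustum" for c u
      using horo_argument[OF spatial.norm_series_le[OF c] ell2_frustumD(2)[OF c]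
          inner_spatial_series_e0[OF c] test(1)[of n]]
      by (simp_all add: inner_add_left inner_add_right inner_eq inner_spatial_series_e0[OF c]
          spatial.inner_series_e ell2_frustumD(4)[OF c])
    have "horo_log (sqrt 2 - a n) r = horo_log (sqrt 2 - b n) r"
      using eq'[of n] \<open>r = t\<close>
      unfolding hyperbolic_hori_test_point[OF p] hyperbolic_hori_test_point[OF q] by simp
    then have "sqrt 2 - a n = sqrt 2 - b n"
      by (rule horo_log_inj[OF *[OF p] *[OF q, folded \<open>r = t\<close>]])
    then show ?thesis by simp
  qed
  with \<open>r = t\<close> show ?thesis by auto
qed

lemma continuous_on_horo_log:
  assumes "y \<in> hyperbolic_space e"
  shows "continuous_on ell2_frustum
    (\<lambda>p. horo_log (inner y (e 0) - inner (spatial.series (fst p)) y) (snd p))"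
proof -
  have nz: "inner y (e 0) - inner (spatial.series (fst p)) y
      + sqrt ((inner y (e 0) - inner (spatial.series (fst p)) y)\<^sup>2 - (1 - (snd p)\<^sup>2)) \<noteq> 0"
    if "p \<in> ell2_frustum" for p
  proof -
    have p: "(fst p, snd p) \<in> ell2_frustum" using that by simp
    note A = horo_argument[OF spatial.norm_series_le[OF p] ell2_frustumD(2)[OF p]
        inner_spatial_series_e0[OF p] assms]
    then show ?thesis by (intro less_imp_neq[THEN not_sym] add_pos_nonneg) auto
  qed
  show ?thesis
    unfolding horo_log_def
    by (intro continuous_on_ln continuous_on_add continuous_on_diff
        continuous_on_real_sqrt continuous_on_const continuous_on_power
        continuous_on_snd[OF continuous_on_id] spatial.continuous_on_inner_series ballI nz)
qed

lemma hyperbolic_horicompactification: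
  "horicompactification (hyperbolic_space e) (hyperbolic_dist e) homeomorphic_space top_of_set ell2_frustum"
proof (rule horicompactification_homeomorphic_compact
    [where \<Phi> = "\<lambda>y z p. hyperbolic_hori y z (spatial.series (fst p)) (snd p)", OF compact_ell2_frustum
      ell2_frustum_side_subset ell2_frustum_subset_closure_side])
  show "\<bar>hyperbolic_dist e x y - hyperbolic_dist e x z\<bar> \<le> hyperbolic_dist e y z"
    if "x \<in> hyperbolic_space e" "y \<in> hyperbolic_space e" "z \<in> hyperbolic_space e" for x y z
    using hyperbolic_dist_triangle[of x y z] hyperbolic_dist_triangle[of x z y] that
    by (simp add: hyperbolic_dist_def lorentz_form_commute[of z y])
  show "continuous_on ell2_frustum (\<lambda>p. hyperbolic_hori y z (spatial.series (fst p)) (snd p))"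
    if "y \<in> hyperbolic_space e" "z \<in> hyperbolic_space e" for y z
    unfolding hyperbolic_hori_def using that by (intro continuous_on_diff continuous_on_horo_log)
  show "p = q" if "p \<in> ell2_frustum" "q \<in> ell2_frustum"
    "\<And>y z. \<lbrakk>y \<in> hyperbolic_space e; z \<in> hyperbolic_space e; y \<noteq> z\<rbrakk> \<Longrightarrow>
      hyperbolic_hori y z (spatial.series (fst p)) (snd p)
      = hyperbolic_hori y z (spatial.series (fst q)) (snd q)" for p q
    using hyperbolic_hori_inj[of "fst p" "snd p" "fst q" "snd q"] that by simp
  show "\<exists>q\<in>ell2_frustum. \<forall>y\<in>hyperbolic_space e. \<forall>z\<in>hyperbolic_space e. y \<noteq> z \<longrightarrow>
      hyperbolic_hori y z (spatial.series (fst q)) (snd q) = hyperbolic_dist e x y - hyperbolic_dist e x z"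
    if x: "x \<in> hyperbolic_space e" for x
  proof -
    note X = hyperbolic_space_norm[OF x]
    \<comment> \<open>Projection to the Klein model: rescale \<open>x\<close> to time coordinate 1.
      The equation of the hyperboloid becomes
      \<open>1 - (norm v)\<^sup>2 = 1 / c\<^sup>2\<close>.\<close>
    define c where "c = inner x (e 0)"
    define v where "v = x /\<^sub>R c - e 0"
    have "c > 0" using X(2) by (simp add: c_def)
    have v0: "inner v (e 0) = 0"
      using \<open>c > 0\<close> by (simp add: v_def inner_diff_left inner_eq flip: c_def)
    have "c *\<^sub>R (e 0 + v) = x" using \<open>c > 0\<close> by (simp add: v_def)
    have "(norm (e 0 + v))\<^sup>2 = 1 + (norm v)\<^sup>2"
      using v0 by (simp add: power2_norm_eq_inner inner_add_left inner_add_right inner_eq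
          inner_commute[of "e 0" v])
    then have "(norm x)\<^sup>2 = c\<^sup>2 * (1 + (norm v)\<^sup>2)"
      unfolding \<open>c *\<^sub>R (e 0 + v) = x\<close>[symmetric] by (simp add: power_mult_distrib)
    then have "c\<^sup>2 * (1 - (norm v)\<^sup>2) = 1" using X(1) by (simp add: algebra_simps flip: c_def)
    then have v2: "1 - (norm v)\<^sup>2 = (inverse c)\<^sup>2"
      using \<open>c > 0\<close> by (simp add: power_inverse inverse_unique)
    then have "sqrt (1 - (norm v)\<^sup>2) = inverse c" using \<open>c > 0\<close> by simp
    then have xv: "(e 0 + v) /\<^sub>R sqrt (1 - (norm v)\<^sup>2) = x"
      using \<open>c *\<^sub>R (e 0 + v) = x\<close> by simp
    have "0 < (inverse c)\<^sup>2" using \<open>c > 0\<close> by simp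
    then have "(norm v)\<^sup>2 < 1" using v2 by linarith
    then have v1: "norm v < 1" by (simp add: abs_square_less_1)
    \<comment> \<open>The spatial sequence alone is not complete; \<open>v\<close> is recovered
      because its \<open>e 0\<close> coordinate also vanishes.\<close>
    have "v - spatial.series (\<lambda>i. inner v (e (Suc i))) = 0"
    proof (rule total)
      fix i show "inner (v - spatial.series (\<lambda>i. inner v (e (Suc i)))) (e i) = 0"
      proof (cases i)
        case 0
        have "(\<lambda>i. inner v (e (Suc i)), norm v) \<in> ell2_frustum"
          using v1 by (intro spatial.coordinates_in_ell2_frustum) auto
        then show ?thesis using v0 inner_spatial_series_e0 by (simp add: 0 inner_diff_left)
      qed (simp add: spatial.inner_minus_series_coordinates)
    qed
    moreover have "(\<lambda>i. inner v (e (Suc i)), norm v) \<in> ell2_frustum"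
      using v1 by (intro spatial.coordinates_in_ell2_frustum) auto
    ultimately show ?thesis
      using hyperbolic_hori_eq_dist(2)[OF v0 refl v1] unfolding xv
      by (intro bexI[of _ "(\<lambda>i. inner v (e (Suc i)), norm v)"]) simp_all
  qed
  show "\<exists>x\<in>hyperbolic_space e. \<forall>y\<in>hyperbolic_space e. \<forall>z\<in>hyperbolic_space e. y \<noteq> z \<longrightarrow>
      hyperbolic_hori y z (spatial.series (fst q)) (snd q) = hyperbolic_dist e x y - hyperbolic_dist e x z"
    if "q \<in> ell2_frustum_side" for q
  proof -
    obtain a r where q: "q = (a, r)" by force
    have 1: "inner (spatial.series a) (e 0) = 0"
      using inner_spatial_series_e0[of a r] ell2_frustum_side_subset that q by blast
    have 2: "norm (spatial.series a) = r" using spatial.norm_series_side[of a r] that q by simp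
    have 3: "r < 1" using that q by (auto simp: ell2_frustum_side_def)
    show ?thesis
      using hyperbolic_hori_eq_dist[OF 1 2 3] unfolding q fst_conv snd_conv by blast
  qed
qed

end

theorem theorem1p1:
  fixes e :: "nat \<Rightarrow> 'h::{real_inner, complete_space}"
  assumes "infinite_dimensional (UNIV :: 'h set)"
    and "separable_space (euclidean :: 'h topology)"
    and "hilbert_basis e"
    and "infinite_dimensional (UNIV :: 'd::{real_inner, complete_space} set)"
    and "separable_space (euclidean :: 'd topology)"
  shows "horicompactification (hyperbolic_space e) (hyperbolic_dist e)
           homeomorphic_space (frustum :: ('d \<times> real) topology)
       \<and> horicompactification (UNIV :: 'h set) dist
           homeomorphic_space (frustum :: ('d \<times> real) topology)"
proof -
  interpret complete_orthonormal_sequence e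
    by (rule hilbert_basis_imp_complete_orthonormal_sequence[OF assms(3)])
  \<comment> \<open>The ball may lie in another Hilbert space; \<open>ell2_frustum\<close> is the
    common model.\<close>
  obtain f :: "nat \<Rightarrow> 'd" where "complete_orthonormal_sequence f"
    using ex_complete_orthonormal_sequence[OF assms(4,5)] by blast
  then have "top_of_set ell2_frustum homeomorphic_space (frustum :: ('d \<times> real) topology)"
    using complete_orthonormal_sequence.frustum_homeomorphic homeomorphic_space_sym by blast
  then show ?thesis
    using hyperbolic_horicompactification hilbert_horicompactification homeomorphic_space_trans by blast
qed

end
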